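(* Consider an elliptic law $\mathbb{P}$ on environments on $\mathbb{Z}^d$ under which $\{\omega(x):x\in\mathbb{Z}^d\}$ are i.i.d. Assume that there exists $r>1$ such that $\omega(0,e_1)=r\,\omega(0,e_{1+d})$ $\mathbb{P}$-a.s. (where $e_{1+d}=-e_1$). Then the polynomial condition $(P)_M\mid e_1$ is satisfied for some $M\ge15d+5$.
   Context: Environment and walk. Let $U=\{e\in\mathbb{Z}^d:|e|_1=1\}=\{e_1,\dots,e_{2d}\}$ with $e_1,\dots,e_d$ the canonical basis and $e_{d+i}=-e_i$ for $1\le i\le d$. Let $\mathcal{P}=\{(p(e))_{e\in U}: p(e)\ge 0,\ \sum_{e\in U}p(e)=1\}$ and $\Omega=\mathcal{P}^{\mathbb{Z}^d}$. An environment is $\omega=\{\omega(x):x\in\mathbb{Z}^d\}\in\Omega$, with components $\omega(x,e)$. For $\omega\in\Omega$, $P_{x,\omega}$ is the law of the Markov chain $(X_n)_{n\ge0}$ on $\mathbb{Z}^d$ with $X_0=x$ and $P_{x,\omega}(X_{n+1}=y+e\mid X_n=y)=\omega(y,e)$. $\mathbb{P}$ is a probability measure on $\Omega$, $\mathbb{E}$ its expectation; $P_x=\int P_{x,\omega}\,d\mathbb{P}(\omega)$ is the annealed law. $\mathbb{P}$ is elliptic if $\mathbb{P}(\omega(x,e)>0)=1$ for all $x\in\mathbb{Z}^d$, $e\in U$. Polynomial condition. For $l\in\mathbb{S}^{d-1}$ let $H_l=\{l'\in\mathbb{R}^d: l'\cdot l\ge 0\}$. For $L,\tilde L>0$ let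 $B_{l,L,\tilde L}=R\big((-L,L)\times(-\tilde L,\tilde L)^{d-1}\big)\cap\mathbb{Z}^d$, where $R$ is a rotation of $\mathbb{R}^d$ with $R(e_1)=l$. For $A\subset\mathbb{Z}^d$ let $T_A=\min\{n\ge0:X_n\notin A\}$. As a standing assumption, there is an $\alpha>0$ such that $\eta_\alpha:=\max_{e\in H_l\cap U}\mathbb{E}\big(\omega(0,e)^{-\alpha}\big)<\infty$ (here with $l=e_1$); fix such an $\alpha$ and let $$c_0=\tfrac23\,3^{\,120d^4+3000d\left(\frac1\alpha\log\eta_\alpha\right)^2}.$$ For $M\ge1$, condition $(P)_M\mid l$ holds if there exist $L\ge c_0$ and $\tilde L\le 70L^3$ such that $P_0\big(X_{T_{B_{l,L,\tilde L}}}\cdot l<L\big)\le L^{-M}$. *)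

theory Defs
  imports "HOL-Probability.Probability"
begin

text \<open>
  The lattice of dimension \<open>d\<close> is \<open>int ^ 'd\<close> with \<open>d = CARD('d)\<close>. An index \<open>k :: 'd\<close> plays the
  role of the first coordinate, so that \<open>axis k 1\<close> is the first canonical basis vector.
\<close>

type_synonym 'd env = "int ^ 'd \<Rightarrow> int ^ 'd \<Rightarrow> real"

definition real_vec :: "int ^ 'd::finite \<Rightarrow> real ^ 'd" where
  "real_vec z = (\<chi> i. real_of_int (z $ i))"

definition unit_steps :: "(int ^ 'd::finite) set" where
  "unit_steps = {e. (\<Sum>i\<in>UNIV. \<bar>e $ i\<bar>) = 1}"

definition transition_vectors :: "(int ^ 'd::finite \<Rightarrow> real) set" where
  "transition_vectors = {p. (\<forall>e\<in>unit_steps. 0 \<le> p e) \<and> (\<Sum>e\<in>unit_steps. p e) = 1}"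

definition site_space :: "(int ^ 'd::finite \<Rightarrow> real) measure" where
  "site_space = restrict_space (\<Pi>\<^sub>M e\<in>unit_steps. borel) transition_vectors"

definition env_space :: "'d::finite env measure" where
  "env_space = (\<Pi>\<^sub>M x\<in>UNIV. site_space)"

definition path_space :: "(nat \<Rightarrow> int ^ 'd::finite) measure" where
  "path_space = (\<Pi>\<^sub>M n\<in>UNIV. count_space UNIV)"

definition step_law :: "'d::finite env \<Rightarrow> int ^ 'd \<Rightarrow> (int ^ 'd) measure" where
  "step_law \<omega> y =
     density (count_space UNIV) (\<lambda>z. if z - y \<in> unit_steps then ennreal (\<omega> y (z - y)) else 0)"

text \<open>
  The conditional law of the position at time \<open>n\<close> given the positions \<open>h\<close> at the times before \<open>n\<close>,
  for the walk started at \<open>x\<close>.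
\<close>

definition walk_kernel ::
    "'d::finite env \<Rightarrow> int ^ 'd \<Rightarrow> nat \<Rightarrow> (nat \<Rightarrow> int ^ 'd) \<Rightarrow> (int ^ 'd) measure" where
  "walk_kernel \<omega> x n h = (case n of 0 \<Rightarrow> return (count_space UNIV) x | Suc m \<Rightarrow> step_law \<omega> (h m))"

text \<open>
  The law of the chain on path space, given by the Ionescu-Tulcea theorem. It is only meaningful
  for \<open>\<omega> \<in> space env_space\<close>.
\<close>

definition quenched_law :: "'d::finite env \<Rightarrow> int ^ 'd \<Rightarrow> (nat \<Rightarrow> int ^ 'd) measure" where
  "quenched_law \<omega> x =
     projective_family.lim UNIV
       (Ionescu_Tulcea.CI (walk_kernel \<omega> x) (\<lambda>_. count_space UNIV)) (\<lambda>_. count_space UNIV)"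

definition annealed_law ::
    "'d::finite env measure \<Rightarrow> int ^ 'd \<Rightarrow> (nat \<Rightarrow> int ^ 'd) measure" where
  "annealed_law \<PP> x = \<PP> \<bind> (\<lambda>\<omega>. quenched_law \<omega> x)"

definition iid_env :: "'d::finite env measure \<Rightarrow> bool" where
  "iid_env \<PP> \<longleftrightarrow>
     prob_space.indep_vars \<PP> (\<lambda>_. site_space) (\<lambda>x \<omega>. \<omega> x) UNIV \<and>
     (\<forall>x. distr \<PP> site_space (\<lambda>\<omega>. \<omega> x) = distr \<PP> site_space (\<lambda>\<omega>. \<omega> 0))"

definition elliptic :: "'d::finite env measure \<Rightarrow> bool" where
  "elliptic \<PP> \<longleftrightarrow> (\<forall>x. \<forall>e\<in>unit_steps. AE \<omega> in \<PP>. 0 < \<omega> x e)"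

text \<open>
  Since the inverse of \<open>0\<close> in \<open>ennreal\<close> is infinite, the integrand below is infinite where
  \<open>\<omega> 0 e = 0\<close>, which \<open>\<omega> 0 e powr (- \<alpha>)\<close> would not be.
\<close>

definition eta :: "'d::finite env measure \<Rightarrow> real ^ 'd \<Rightarrow> real \<Rightarrow> ennreal" where
  "eta \<PP> l \<alpha> =
     Max ((\<lambda>e. \<integral>\<^sup>+\<omega>. inverse (ennreal (\<omega> 0 e powr \<alpha>)) \<partial>\<PP>) ` {e \<in> unit_steps. 0 \<le> real_vec e \<bullet> l})"

definition c0 :: "'d::finite env measure \<Rightarrow> real ^ 'd \<Rightarrow> real \<Rightarrow> real" where
  "c0 \<PP> l \<alpha> =
     2 / 3 * 3 powr (120 * real CARD('d) ^ 4 +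
       3000 * real CARD('d) * (1 / \<alpha> * ln (enn2real (eta \<PP> l \<alpha>))) ^ 2)"

text \<open>
  The rotation \<open>R\<close> is meant to take \<open>axis k 1\<close> to the direction of interest.
\<close>

definition rotated_box :: "'d::finite \<Rightarrow> real ^ 'd ^ 'd \<Rightarrow> real \<Rightarrow> real \<Rightarrow> (int ^ 'd) set" where
  "rotated_box k R L L' =
     {z. real_vec z \<in> (\<lambda>v. R *v v) ` {v. \<bar>v $ k\<bar> < L \<and> (\<forall>i. i \<noteq> k \<longrightarrow> \<bar>v $ i\<bar> < L')}}"

definition exit_time :: "(int ^ 'd::finite) set \<Rightarrow> (nat \<Rightarrow> int ^ 'd) \<Rightarrow> enat" where
  "exit_time A X = (INF n\<in>{n. X n \<notin> A}. enat n)"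

text \<open>
  A path that never leaves \<open>A\<close> is counted in this event. For a bounded \<open>A\<close> and an elliptic law such
  paths have annealed probability \<open>0\<close>.
\<close>

definition bad_exit :: "(int ^ 'd::finite) set \<Rightarrow> real ^ 'd \<Rightarrow> real \<Rightarrow> (nat \<Rightarrow> int ^ 'd) set" where
  "bad_exit A l L = {X. \<forall>n. exit_time A X = enat n \<longrightarrow> real_vec (X n) \<bullet> l < L}"

definition polynomial_condition ::
    "'d::finite env measure \<Rightarrow> real \<Rightarrow> 'd \<Rightarrow> real ^ 'd ^ 'd \<Rightarrow> real \<Rightarrow> real ^ 'd \<Rightarrow> bool" where
  "polynomial_condition \<PP> \<alpha> k R M l \<longleftrightarrow>
     (\<exists>L L'. c0 \<PP> l \<alpha> \<le> L \<and> 0 < L' \<and> L' \<le> 70 * L ^ 3 \<and>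
        measure (annealed_law \<PP> 0) (bad_exit (rotated_box k R L L') l L) \<le> L powr (- M))"

text \<open>
  The facts below confirm that the laws above are what they should be: \<open>quenched_law\<close> is a probability
  measure with the finite-dimensional distributions of the chain, it depends measurably on the
  environment, and \<open>annealed_law\<close> is its average on all events, in particular on \<open>bad_exit\<close>.
\<close>

lemma finite_unit_steps: "finite (unit_steps :: (int ^ 'd::finite) set)"
proof -
  have "vec_nth ` (unit_steps :: (int ^ 'd) set) \<subseteq> (\<Pi>\<^sub>E i\<in>UNIV. {-1..1})"
  proof (clarsimp simp: unit_steps_def PiE_iff)
    fix x :: "int ^ 'd" and i assume s: "(\<Sum>i\<in>UNIV. \<bar>x $ i\<bar>) = 1"
    have "\<bar>x $ i\<bar> \<le> (\<Sum>i\<in>UNIV. \<bar>x $ i\<bar>)" by (rule member_le_sum) auto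
    with s show "- 1 \<le> x $ i \<and> x $ i \<le> 1" by linarith
  qed
  then have "finite (vec_nth ` (unit_steps :: (int ^ 'd) set))"
    by (rule finite_subset) (intro finite_PiE, auto)
  then show ?thesis by (rule finite_imageD) (auto simp: inj_on_def vec_eq_iff)
qed

lemma space_env_spaceD:
  assumes "\<omega> \<in> space env_space"
  shows "e \<in> unit_steps \<Longrightarrow> 0 \<le> \<omega> y e" and "(\<Sum>e\<in>unit_steps. \<omega> y e) = 1"
  using assms by (auto simp: env_space_def site_space_def space_PiM space_restrict_space
      transition_vectors_def PiE_iff)

lemma prob_space_step_law:
  assumes "\<omega> \<in> space env_space"
  shows "prob_space (step_law \<omega> y)"
proof
  have "(\<integral>\<^sup>+z. (if z - y \<in> unit_steps then ennreal (\<omega> y (z - y)) else 0) \<partial>count_space UNIV) =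
    (\<Sum>z\<in>(+) y ` unit_steps. if z - y \<in> unit_steps then ennreal (\<omega> y (z - y)) else 0)"
  proof (rule nn_integral_count_space')
    show "(if z - y \<in> unit_steps then ennreal (\<omega> y (z - y)) else 0) = 0"
      if "z \<notin> (+) y ` unit_steps" for z
      using that by (metis add_diff_cancel_left' add.commute diff_add_cancel image_eqI)
  qed (simp_all add: finite_unit_steps)
  also have "\<dots> = (\<Sum>e\<in>unit_steps. ennreal (\<omega> y e))"
    by (subst sum.reindex) (auto simp: inj_on_def)
  also have "\<dots> = 1"
    using space_env_spaceD[OF assms] by (subst sum_ennreal) auto
  finally show "emeasure (step_law \<omega> y) (space (step_law \<omega> y)) = 1"
    by (simp add: step_law_def emeasure_density)
qed

lemma emeasure_step_law:
  "emeasure (step_law \<omega> y) {z} = (if z - y \<in> unit_steps then ennreal (\<omega> y (z - y)) else 0)"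
  by (simp add: step_law_def emeasure_density nn_integral_count_space_indicator)

lemma Ionescu_Tulcea_walk_kernel:
  fixes \<omega> :: "'d::finite env"
  assumes "\<omega> \<in> space env_space"
  shows "Ionescu_Tulcea (walk_kernel \<omega> x) (\<lambda>_. count_space UNIV)"
proof -
  have *: "step_law \<omega> \<in> count_space UNIV \<rightarrow>\<^sub>M subprob_algebra (count_space UNIV)"
    using prob_space_step_law[OF assms]
    by (auto simp: space_subprob_algebra prob_space_imp_subprob_space step_law_def)
  have 1: "walk_kernel \<omega> x i \<in> (\<Pi>\<^sub>M i\<in>{0..<i}. count_space UNIV) \<rightarrow>\<^sub>M subprob_algebra (count_space UNIV)" for i
  proof (cases i)
    case (Suc m)
    have "(\<lambda>h. h m) \<in> (\<Pi>\<^sub>M i\<in>{0..<i}. count_space (UNIV :: (int ^ 'd) set)) \<rightarrow>\<^sub>M count_space UNIV"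
      by (rule measurable_component_singleton) (simp add: Suc)
    from measurable_compose[OF this *] show ?thesis
      by (simp add: walk_kernel_def[abs_def] Suc)
  next
    case 0
    have "return (count_space UNIV) x \<in> space (subprob_algebra (count_space UNIV))"
      by (auto simp: space_subprob_algebra prob_space_imp_subprob_space prob_space_return)
    then show ?thesis by (simp add: walk_kernel_def[abs_def] 0)
  qed
  have 2: "prob_space (walk_kernel \<omega> x i h)" for i h
    using prob_space_step_law[OF assms] by (auto simp: walk_kernel_def prob_space_return split: nat.split)
  show ?thesis by (rule Ionescu_Tulcea.intro) (rule 1 2)+
qed

lemma
  assumes "\<omega> \<in> space env_space"
  shows sets_quenched_law: "sets (quenched_law \<omega> x) = sets path_space"
    and space_quenched_law: "space (quenched_law \<omega> x) = UNIV"
proof -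
  interpret Ionescu_Tulcea "walk_kernel \<omega> x" "\<lambda>_. count_space UNIV"
    by (rule Ionescu_Tulcea_walk_kernel[OF assms])
  show "sets (quenched_law \<omega> x) = sets path_space" "space (quenched_law \<omega> x) = UNIV"
    unfolding quenched_law_def path_space_def by (simp_all add: space_PiM)
qed

lemma prob_space_quenched_law:
  assumes "\<omega> \<in> space env_space"
  shows "prob_space (quenched_law \<omega> x)"
proof -
  interpret Ionescu_Tulcea "walk_kernel \<omega> x" "\<lambda>_. count_space UNIV"
    by (rule Ionescu_Tulcea_walk_kernel[OF assms])
  have "prob_space (distr PF.lim (PiM {} (\<lambda>_. count_space UNIV)) (\<lambda>h. restrict h {}))"
    by (subst distr_lim) (auto intro: PF.prob_space_P)
  then show ?thesis
    unfolding quenched_law_def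
    by (rule prob_space_distrD[rotated]) (auto intro!: measurable_restrict simp: measurable_cong_sets[OF PF.sets_lim refl])
qed

lemma emeasure_quenched_law_cylinder:
  fixes \<omega> :: "'d::finite env"
  assumes "\<omega> \<in> space env_space"
  shows "emeasure (quenched_law \<omega> x) {X. \<forall>i\<le>n. X i = z i} =
    (if z 0 = x then \<Prod>i<n. (if z (Suc i) - z i \<in> unit_steps
       then ennreal (\<omega> (z i) (z (Suc i) - z i)) else 0) else 0)"
proof -
  interpret Ionescu_Tulcea "walk_kernel \<omega> x" "\<lambda>_. count_space UNIV"
    by (rule Ionescu_Tulcea_walk_kernel[OF assms])
  let ?M = "\<lambda>n. \<Pi>\<^sub>M i\<in>{0..<n::nat}. count_space (UNIV :: (int ^ 'd) set)"
  have sgl: "{restrict z {0..<n}} \<in> sets (?M n)" for n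
  proof -
    have "{restrict z {0..<n}} = (\<Pi>\<^sub>E i\<in>{0..<n}. {z i})"
      by (auto simp: PiE_eq_singleton PiE_iff fun_eq_iff extensional_def)
    then show ?thesis by (auto intro!: sets_PiM_I_finite)
  qed
  have spc: "space (?M n) = extensional {0..<n}" for n
    by (auto simp: space_PiM PiE_def)
  have step: "emeasure (C 0 (Suc n) (\<lambda>_. undefined)) {restrict z {0..<Suc n}} =
      emeasure (C 0 n (\<lambda>_. undefined)) {restrict z {0..<n}} *
      emeasure (walk_kernel \<omega> x n (restrict z {0..<n})) {z n}" for n
  proof -
    have ne: "space (C 0 n (\<lambda>_. undefined)) \<noteq> {}"
      using prob_space_C[of "\<lambda>_. undefined" 0 n] by (simp add: prob_space.not_empty)
    have "emeasure (C 0 (Suc n) (\<lambda>_. undefined)) {restrict z {0..<Suc n}} =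
       (\<integral>\<^sup>+h. emeasure (eP n h) {restrict z {0..<Suc n}} \<partial>C 0 n (\<lambda>_. undefined))"
      using ne measurable_eP[of n] sgl[of "Suc n"]
      by (simp del: restrict_apply, subst emeasure_bind[where N="?M (Suc n)"])
         (auto simp: measurable_cong_sets[OF sets_C refl])
    also have "\<dots> = (\<integral>\<^sup>+h. emeasure (walk_kernel \<omega> x n (restrict z {0..<n})) {z n} *
        indicator {restrict z {0..<n}} h \<partial>C 0 n (\<lambda>_. undefined))"
    proof (rule nn_integral_cong)
      fix h assume "h \<in> space (C 0 n (\<lambda>_. undefined))"
      then have h: "h \<in> space (?M n)" by (subst (asm) space_C) auto
      have "h(n := y) = restrict z {0..<Suc n} \<longleftrightarrow> h = restrict z {0..<n} \<and> y = z n" for y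
      proof
        assume eq: "h(n := y) = restrict z {0..<Suc n}"
        have "h i = restrict z {0..<n} i" for i
          using fun_cong[OF eq, of i] h by (cases "i < n") (auto simp: spc extensional_def)
        moreover have "y = z n"
          using fun_cong[OF eq, of n] by simp
        ultimately show "h = restrict z {0..<n} \<and> y = z n" by blast
      qed (auto simp: fun_eq_iff)
      then have "(\<lambda>y. h(n := y)) -` {restrict z {0..<Suc n}} = {y. h = restrict z {0..<n} \<and> y = z n}"
        unfolding vimage_def singleton_iff by (rule Collect_cong)
      then have "emeasure (eP n h) {restrict z {0..<Suc n}} =
          emeasure (walk_kernel \<omega> x n h) {y. h = restrict z {0..<n} \<and> y = z n}"
        unfolding emeasure_eP[OF h sgl] by simp
      also have "\<dots> = emeasure (walk_kernel \<omega> x n (restrict z {0..<n})) {z n} * indicator {restrict z {0..<n}} h"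
        by (cases "h = restrict z {0..<n}") simp_all
      finally show "emeasure (eP n h) {restrict z {0..<Suc n}} =
        emeasure (walk_kernel \<omega> x n (restrict z {0..<n})) {z n} * indicator {restrict z {0..<n}} h" .
    qed
    also have "\<dots> = emeasure (walk_kernel \<omega> x n (restrict z {0..<n})) {z n} *
        emeasure (C 0 n (\<lambda>_. undefined)) {restrict z {0..<n}}"
      using sgl[of n] by (subst nn_integral_cmult_indicator) (auto simp: sets_C)
    finally show ?thesis by (simp add: mult.commute)
  qed
  have c: "emeasure (C 0 (Suc n) (\<lambda>_. undefined)) {restrict z {0..<Suc n}} =
    (if z 0 = x then \<Prod>i<n. (if z (Suc i) - z i \<in> unit_steps
       then ennreal (\<omega> (z i) (z (Suc i) - z i)) else 0) else 0)" for n
  proof (induction n)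
    case 0
    have "emeasure (C 0 0 (\<lambda>_. undefined)) {restrict z {0..<0}} = 1"
      using sgl[of 0] by (simp add: restrict_def)
    then show ?case by (subst step) (auto simp: walk_kernel_def)
  next
    case (Suc n)
    have "emeasure (walk_kernel \<omega> x (Suc n) (restrict z {0..<Suc n})) {z (Suc n)} =
        (if z (Suc n) - z n \<in> unit_steps then ennreal (\<omega> (z n) (z (Suc n) - z n)) else 0)"
      by (simp add: walk_kernel_def emeasure_step_law)
    then show ?case unfolding step[of "Suc n"] Suc.IH by simp
  qed
  have "(\<forall>i\<le>n. X i = z i) \<longleftrightarrow> restrict X {0..<Suc n} = restrict z {0..<Suc n}" for X
    by (auto simp: restrict_def fun_eq_iff less_Suc_eq_le)
  then have e: "{X. \<forall>i\<le>n. X i = z i} =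
      prod_emb UNIV (\<lambda>_. count_space UNIV) {0..<Suc n} {restrict z {0..<Suc n}}"
    by (auto simp: prod_emb_def)
  have "emeasure (quenched_law \<omega> x) {X. \<forall>i\<le>n. X i = z i} =
      emeasure (CI {0..<Suc n}) {restrict z {0..<Suc n}}"
    unfolding quenched_law_def e by (rule lim) (auto intro: sgl)
  also have "\<dots> = emeasure (C 0 (Suc n) (\<lambda>_. undefined)) {restrict z {0..<Suc n}}"
  proof -
    have "prod_emb {0..<Suc n} (\<lambda>_. count_space UNIV) {0..<Suc n} {restrict z {0..<Suc n}} =
        {restrict z {0..<Suc n}}"
      by (rule prod_emb_id) (auto simp: PiE_def)
    then show ?thesis
      using sgl[of "Suc n"] by (subst emeasure_CI[of _ "Suc n"]) auto
  qed
  finally show ?thesis unfolding c .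
qed

lemma sets_bad_exit: "bad_exit A l L \<in> sets path_space"
proof -
  have [measurable]: "(\<lambda>X. X n) \<in> path_space \<rightarrow>\<^sub>M count_space UNIV" for n
    unfolding path_space_def by (rule measurable_component_singleton) simp
  have "exit_time A X = enat n \<longleftrightarrow> X n \<notin> A \<and> (\<forall>m<n. X m \<in> A)" for X n
  proof (cases "\<exists>n. X n \<notin> A")
    case True
    define m where "m = (LEAST n. X n \<notin> A)"
    have m: "X m \<notin> A" "\<And>n. X n \<notin> A \<Longrightarrow> m \<le> n"
      unfolding m_def using LeastI_ex[OF True] by (auto intro: Least_le)
    have "exit_time A X = enat m"
      unfolding exit_time_def
      by (intro antisym INF_lower2[of m] INF_greatest) (use m in auto)
    moreover have "m = n \<longleftrightarrow> X n \<notin> A \<and> (\<forall>m<n. X m \<in> A)"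
      using m by (metis le_neq_implies_less not_less)
    ultimately show ?thesis by simp
  qed (simp add: exit_time_def top_enat_def)
  then have "bad_exit A l L = {X\<in>space path_space. \<forall>n. X n \<notin> A \<and> (\<forall>m<n. X m \<in> A) \<longrightarrow> real_vec (X n) \<bullet> l < L}"
    by (simp add: bad_exit_def path_space_def space_PiM)
  also have "\<dots> \<in> sets path_space" by measurable
  finally show ?thesis .
qed

lemma quenched_law_measurable:
  fixes x :: "int ^ 'd::finite"
  shows "(\<lambda>\<omega>. quenched_law \<omega> x) \<in> env_space \<rightarrow>\<^sub>M prob_algebra path_space"
proof -
  let ?cyl = "\<lambda>(n, z). {X :: nat \<Rightarrow> int ^ 'd. \<forall>i\<le>n. X i = z i}"
  let ?G = "insert {} (range ?cyl)"
  have 1: "sets path_space = sigma_sets UNIV ?G"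
  proof (rule antisym)
    have "{X. X i = a} \<in> sigma_sets UNIV ?G" for i and a :: "int ^ 'd"
    proof -
      have eq: "{X. X i = a} = (\<Union>z\<in>{z \<in> {..i} \<rightarrow>\<^sub>E UNIV. z i = a}. ?cyl (i, z))"
      proof (safe, goal_cases)
        case (1 X)
        then show ?case by (intro UN_I[of "restrict X {..i}"]) auto
      qed auto
      have "countable {z \<in> {..i} \<rightarrow>\<^sub>E (UNIV :: (int ^ 'd) set). z i = a}"
        by (rule countable_subset[OF _ countable_PiE[of "{..i}" "\<lambda>_. UNIV"]]) auto
      then show ?thesis
        unfolding eq by (intro sigma_sets_UNION) (auto intro!: sigma_sets.Basic)
    qed
    note s = this
    have "{X. X i \<in> A} \<in> sigma_sets UNIV ?G" for i and A :: "(int ^ 'd) set"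
    proof -
      have eq: "{X. X i \<in> A} = (\<Union>a\<in>A. {X. X i = a})" by auto
      show ?thesis
        unfolding eq by (intro sigma_sets_UNION) (auto intro: s)
    qed
    then show "sets path_space \<subseteq> sigma_sets UNIV ?G"
      unfolding path_space_def sets_PiM_single
      by (auto simp: PiE_UNIV_domain intro!: sigma_sets_mono)
    have [measurable]: "(\<lambda>X. X n) \<in> path_space \<rightarrow>\<^sub>M count_space UNIV" for n
      unfolding path_space_def by (rule measurable_component_singleton) simp
    have sp: "space (path_space :: (nat \<Rightarrow> int ^ 'd) measure) = UNIV"
      by (simp add: path_space_def space_PiM)
    have "{X\<in>space path_space. \<forall>i\<le>n. X i = z i} \<in> sets path_space"
      for n and z :: "nat \<Rightarrow> int ^ 'd" by measurable
    then have "?G \<subseteq> sets path_space"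
      unfolding sp by (auto simp only: insert_subset image_subset_iff prod.case mem_Collect_eq UNIV_I simp_thms sets.empty_sets split: prod.split)
    from sets.sigma_sets_subset[OF this] show "sigma_sets UNIV ?G \<subseteq> sets path_space"
      unfolding sp .
  qed
  show ?thesis
  proof (rule measurable_prob_algebra_generated[OF 1])
    show "Int_stable ?G"
    proof (rule Int_stableI)
      fix A B assume AB: "A \<in> ?G" "B \<in> ?G"
      show "A \<inter> B \<in> ?G"
      proof (cases "A \<inter> B = {}")
        case True
        then show ?thesis by (simp only: insertI1)
      next
        case False
        then obtain X where X: "X \<in> A" "X \<in> B" by blast
        obtain n z where A: "A = {X. \<forall>i\<le>n. X i = z i}" using AB(1) X(1) by auto
        obtain m w where B: "B = {X. \<forall>i\<le>m. X i = w i}" using AB(2) X(2) by auto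
        have Xz: "\<And>i. i \<le> n \<Longrightarrow> z i = X i" and Xw: "\<And>i. i \<le> m \<Longrightarrow> w i = X i"
          using X unfolding A B by simp_all
        have "A \<inter> B = ?cyl (max n m, X)"
          unfolding A B prod.case by (auto simp only: Int_iff mem_Collect_eq le_max_iff_disj Xz Xw)
        then show ?thesis by (simp only: insertI2 rangeI)
      qed
    qed
    show "prob_space (quenched_law \<omega> x)" if "\<omega> \<in> space env_space" for \<omega> :: "'d env"
      by (rule prob_space_quenched_law[OF that])
    show "sets (quenched_law \<omega> x) = sets path_space" if "\<omega> \<in> space env_space" for \<omega> :: "'d env"
      by (rule sets_quenched_law[OF that])
    have m: "(\<lambda>\<omega>. \<omega> y e) \<in> borel_measurable env_space" if "e \<in> unit_steps" for y e :: "int ^ 'd"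
    proof -
      have "(\<lambda>\<omega>. \<omega> y) \<in> env_space \<rightarrow>\<^sub>M site_space"
        unfolding env_space_def by (rule measurable_component_singleton) simp
      moreover have "(\<lambda>p. p e) \<in> borel_measurable site_space"
        unfolding site_space_def
        by (rule measurable_restrict_space1, rule measurable_component_singleton) (rule that)
      ultimately show ?thesis by (rule measurable_compose)
    qed
    show "(\<lambda>\<omega>. emeasure (quenched_law \<omega> x) A) \<in> borel_measurable env_space" if "A \<in> ?G" for A
    proof (cases "A = {}")
      case False
      then obtain n z where A: "A = {X. \<forall>i\<le>n. X i = z i}" using \<open>A \<in> ?G\<close> by auto
      have "(\<lambda>\<omega>. if z (Suc i) - z i \<in> unit_steps then ennreal (\<omega> (z i) (z (Suc i) - z i)) else 0)
          \<in> borel_measurable env_space" for i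
        using m[of "z (Suc i) - z i" "z i"] by (cases "z (Suc i) - z i \<in> unit_steps") auto
      then have "(\<lambda>\<omega>. if z 0 = x then \<Prod>i<n. (if z (Suc i) - z i \<in> unit_steps
         then ennreal (\<omega> (z i) (z (Suc i) - z i)) else 0) else 0) \<in> borel_measurable env_space"
        by (cases "z 0 = x") (auto intro!: borel_measurable_prod_ennreal)
      then show ?thesis
        unfolding A by (subst measurable_cong[OF emeasure_quenched_law_cylinder])
    qed simp
  qed simp
qed

lemma emeasure_annealed_law:
  fixes \<PP> :: "'d::finite env measure"
  assumes "prob_space \<PP>" and "sets \<PP> = sets env_space" and "A \<in> sets path_space"
  shows "emeasure (annealed_law \<PP> x) A = (\<integral>\<^sup>+\<omega>. emeasure (quenched_law \<omega> x) A \<partial>\<PP>)"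
  unfolding annealed_law_def
  by (rule emeasure_bind[OF prob_space.not_empty[OF assms(1)] _ assms(3)])
     (use measurable_prob_algebraD[OF quenched_law_measurable] measurable_cong_sets[OF assms(2) refl] in blast)

end

theory Submission
  imports Defs "HOL-Real_Asymp.Real_Asymp"
begin

text \<open>
  Put \<open>q = 1 / sqrt r\<close> and write \<open>u\<close> for the \<open>k\<close>-th coordinate. One step of the quenched walk from \<open>y\<close>
  multiplies \<open>q ^ u\<close> on average by \<open>1 - (1 - q)\<^sup>2 * \<omega> y e\<^sub>1\<close>. This factor is at most \<open>1\<close>, and at a site
  visited for the first time it is independent of the past, with mean \<open>rate < 1\<close>. Hence
  \<open>q ^ u(X\<^sub>n) / rate ^ (number of distinct sites left before time n)\<close> is an annealed supermartingale.
  Stop it at the exit from a box of half-width \<open>L\<close> along \<open>e\<^sub>1\<close> and half-width \<open>L\<^sup>2\<close> across: an exit through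
  the side requires at least \<open>L\<^sup>2\<close> distinct sites, so for large \<open>L\<close> the value at any bad exit is at least
  \<open>q ^ (- L)\<close>. The bad exit thus has probability at most \<open>q ^ L\<close>, which beats every power of \<open>L\<close>.
  A path that never leaves the box is excluded by the quenched version: in a finite box the factors
  are bounded away from \<open>1\<close>.
\<close>

section \<open>Finite histories of the walk and their quenched probabilities\<close>

text \<open>A history lists the visited sites with the most recent one first.\<close>

primrec histories :: "int ^ 'd::finite \<Rightarrow> nat \<Rightarrow> (int ^ 'd) list set" where
  "histories x 0 = {[x]}"
| "histories x (Suc n) = (\<lambda>(h, e). (hd h + e) # h) ` (histories x n \<times> unit_steps)"

text \<open>On a history this is the quenched probability of following it from its oldest site.
  Being a finite product of transition probabilities, it can be integrated over
  \<open>\<omega>\<close> and factored by independence.\<close>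

primrec weight :: "'d::finite env \<Rightarrow> (int ^ 'd) list \<Rightarrow> real" where
  "weight \<omega> [] = 1"
| "weight \<omega> (y # h) = (if h = [] then 1 else weight \<omega> h * \<omega> (hd h) (y - hd h))"

primrec history :: "(nat \<Rightarrow> 'a) \<Rightarrow> nat \<Rightarrow> 'a list" where
  "history X 0 = [X 0]"
| "history X (Suc n) = X (Suc n) # history X n"

lemma finite_histories: "finite (histories x n)"
  by (induction n) (auto simp: finite_unit_steps)

lemma histories_nonempty: "h \<in> histories x n \<Longrightarrow> h \<noteq> []"
  by (cases n) auto

lemma sum_histories_Suc:
  "(\<Sum>h\<in>histories x (Suc n). f h) = (\<Sum>h\<in>histories x n. \<Sum>e\<in>unit_steps. f ((hd h + e) # h))"
proof -
  have "inj_on (\<lambda>(h, e). (hd h + e) # h) (histories x n \<times> unit_steps)"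
    by (auto simp: inj_on_def)
  then show ?thesis
    by (simp add: sum.reindex sum.cartesian_product case_prod_unfold)
qed

lemma weight_Cons: "h \<noteq> [] \<Longrightarrow> weight \<omega> ((hd h + e) # h) = weight \<omega> h * \<omega> (hd h) e"
  by simp

lemma weight_nonneg:
  assumes "\<omega> \<in> space env_space" "h \<in> histories x n"
  shows "0 \<le> weight \<omega> h"
  using assms(2)
proof (induction n arbitrary: h)
  case (Suc n)
  then show ?case
    using space_env_spaceD(1)[OF assms(1)] by auto
qed simp

lemma sum_weight:
  assumes "\<omega> \<in> space env_space"
  shows "(\<Sum>h\<in>histories x n. weight \<omega> h) = 1"
proof (induction n)
  case (Suc n)
  have "(\<Sum>h\<in>histories x (Suc n). weight \<omega> h) = (\<Sum>h\<in>histories x n. weight \<omega> h * (\<Sum>e\<in>unit_steps. \<omega> (hd h) e))"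
    unfolding sum_histories_Suc sum_distrib_left
    by (intro sum.cong refl weight_Cons) (auto dest: histories_nonempty)
  then show ?case
    using Suc space_env_spaceD(2)[OF assms] by simp
qed simp

lemma weight_le_1:
  assumes "\<omega> \<in> space env_space" "h \<in> histories x n"
  shows "weight \<omega> h \<le> 1"
proof -
  have "weight \<omega> h \<le> (\<Sum>h\<in>histories x n. weight \<omega> h)"
    using assms by (intro member_le_sum weight_nonneg finite_histories) auto
  then show ?thesis by (simp add: sum_weight[OF assms(1)])
qed

lemma history_nonempty: "history X n \<noteq> []"
  by (cases n) auto

lemma hd_history: "hd (history X n) = X n"
  by (cases n) auto

lemma set_history: "set (history X n) = X ` {..n}"
  by (induction n) (auto simp: atMost_Suc)

lemma history_eq_iff: "history X n = history z n \<longleftrightarrow> (\<forall>i\<le>n. X i = z i)"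
  by (induction n) (auto simp: le_Suc_eq)

lemma history_mem_historiesD:
  assumes "history z n \<in> histories x n"
  shows "z 0 = x" and "i < n \<Longrightarrow> z (Suc i) - z i \<in> unit_steps"
  using assms by (induction n) (auto simp: less_Suc_eq hd_history)

lemma history_mem_histories:
  assumes "z 0 = x" and "\<And>i. i < n \<Longrightarrow> z (Suc i) - z i \<in> unit_steps"
  shows "history z n \<in> histories x n"
  using assms(2)
proof (induction n)
  case 0
  then show ?case by (simp add: assms(1))
next
  case (Suc n)
  then have "history z n \<in> histories x n" "z (Suc n) - z n \<in> unit_steps" by auto
  then show ?case
    by (auto intro!: image_eqI[of _ _ "(history z n, z (Suc n) - z n)"] simp: hd_history)
qed

text \<open>Cylinder probabilities are indexed by functions on all times, so a finite history is
  extended to such a function; the values after time \<open>n\<close> are irrelevant.\<close>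

lemma histories_obtain:
  assumes "h \<in> histories x n"
  obtains z where "h = history z n"
proof -
  have "\<exists>z. h = history z n"
    using assms
  proof (induction n arbitrary: h)
    case 0
    then show ?case by (auto intro: exI[of _ "\<lambda>_. x"])
  next
    case (Suc n)
    then obtain h' e where h: "h = (hd h' + e) # h'" "h' \<in> histories x n" by auto
    from Suc.IH[OF h(2)] obtain z where z: "h' = history z n" by auto
    have "history (z(Suc n := hd h' + e)) n = history z n"
      by (subst history_eq_iff) auto
    then show ?case
      by (intro exI[of _ "z(Suc n := hd h' + e)"]) (simp add: h(1) z del: fun_upd_apply, simp)
  qed
  then show ?thesis using that by blast
qed

lemma emeasure_quenched_law_history:
  fixes \<omega> :: "'d::finite env"
  assumes \<omega>: "\<omega> \<in> space env_space" and h: "h \<in> histories x n"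
  shows "emeasure (quenched_law \<omega> x) {X. history X n = h} = ennreal (weight \<omega> h)"
proof -
  obtain z where z: "h = history z n" using histories_obtain[OF h] .
  have "(\<Prod>i<n. (if z (Suc i) - z i \<in> unit_steps then ennreal (\<omega> (z i) (z (Suc i) - z i)) else 0)) =
      ennreal (weight \<omega> (history z n))"
    using h unfolding z
  proof (induction n)
    case (Suc n)
    then have "history z n \<in> histories x n"
      using history_mem_historiesD[OF Suc.prems] by (intro history_mem_histories) auto
    moreover have "z (Suc n) - z n \<in> unit_steps"
      using history_mem_historiesD[OF Suc.prems] by auto
    ultimately show ?case
      using Suc.IH weight_nonneg[OF \<omega>] space_env_spaceD(1)[OF \<omega>]
      by (simp add: hd_history history_nonempty ennreal_mult)
  qed simp
  then show ?thesis
    using history_mem_historiesD(1)[OF h[unfolded z]]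
    unfolding z history_eq_iff emeasure_quenched_law_cylinder[OF \<omega>] by simp
qed

lemma history_measurable: "(\<lambda>X. history X n) \<in> (path_space :: (nat \<Rightarrow> int ^ 'd::finite) measure) \<rightarrow>\<^sub>M count_space UNIV"
proof -
  have [measurable]: "(\<lambda>X. X n) \<in> path_space \<rightarrow>\<^sub>M count_space (UNIV :: (int ^ 'd) set)" for n
    unfolding path_space_def by (rule measurable_component_singleton) simp
  show ?thesis
  proof (induction n)
    case (Suc n)
    note [measurable] = this
    have "(\<lambda>X. (X (Suc n), history X n)) \<in> path_space \<rightarrow>\<^sub>M count_space ((UNIV :: (int ^ 'd) set) \<times> (UNIV :: (int ^ 'd) list set))"
      by (subst pair_measure_countable[symmetric]) auto
    then have "(\<lambda>X. (\<lambda>(a, b). a # b) (X (Suc n), history X n)) \<in> path_space \<rightarrow>\<^sub>M count_space (UNIV :: (int ^ 'd) list set)"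
      by (rule measurable_compose) simp
    then show ?case by simp
  next
    case 0
    have "(\<lambda>X. (\<lambda>a. [a]) (X 0)) \<in> path_space \<rightarrow>\<^sub>M count_space (UNIV :: (int ^ 'd) list set)"
      by (rule measurable_compose[of _ _ "count_space UNIV"]) auto
    then show ?case by simp
  qed
qed

lemma space_path_space: "space path_space = UNIV"
  by (simp add: path_space_def space_PiM)

lemma sets_history: "{X. P (history X n)} \<in> sets path_space"
  using measurable_sets[OF history_measurable, of "Collect P" n]
  by (simp add: space_path_space vimage_def)

text \<open>The weights over the finite set \<open>histories x n\<close> already sum to
  \<open>1\<close>, so almost every path has its history in that set and the rest of
  \<open>P\<close> carries no mass.\<close>

lemma emeasure_quenched_law_history_pred:
  fixes \<omega> :: "'d::finite env"
  assumes \<omega>: "\<omega> \<in> space env_space"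
  shows "emeasure (quenched_law \<omega> x) {X. P (history X n)} =
    ennreal (\<Sum>h\<in>{h\<in>histories x n. P h}. weight \<omega> h)"
proof -
  interpret prob_space "quenched_law \<omega> x" by (rule prob_space_quenched_law[OF \<omega>])
  have s: "{X. P (history X n)} \<in> events" for P
    using sets_history by (simp add: sets_quenched_law[OF \<omega>])
  have *: "emeasure (quenched_law \<omega> x) {X. history X n \<in> {h\<in>histories x n. P h}} =
    ennreal (\<Sum>h\<in>{h\<in>histories x n. P h}. weight \<omega> h)" for P
  proof -
    have "{X. history X n \<in> {h\<in>histories x n. P h}} = (\<Union>h\<in>{h\<in>histories x n. P h}. {X. history X n = h})"
      by auto
    also have "emeasure (quenched_law \<omega> x) \<dots> =
        (\<Sum>h\<in>{h\<in>histories x n. P h}. emeasure (quenched_law \<omega> x) {X. history X n = h})"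
      using s by (intro sum_emeasure[symmetric]) (auto simp: disjoint_family_on_def finite_histories)
    also have "\<dots> = (\<Sum>h\<in>{h\<in>histories x n. P h}. ennreal (weight \<omega> h))"
      by (intro sum.cong emeasure_quenched_law_history[OF \<omega>] refl) auto
    finally show ?thesis
      using weight_nonneg[OF \<omega>] by (subst (asm) sum_ennreal) auto
  qed
  have "prob {X. history X n \<in> histories x n} = 1"
    using *[of "\<lambda>_. True"] by (simp add: sum_weight[OF \<omega>] measure_def)
  then have "AE X in quenched_law \<omega> x. history X n \<in> histories x n"
    using s[of "\<lambda>h. h \<in> histories x n"] prob_Collect_eq_1[of "\<lambda>X. history X n \<in> histories x n"]
    by (simp add: space_quenched_law[OF \<omega>])
  then have "emeasure (quenched_law \<omega> x) {X. P (history X n)} =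
      emeasure (quenched_law \<omega> x) {X. history X n \<in> {h\<in>histories x n. P h}}"
    by (intro emeasure_eq_AE s) auto
  then show ?thesis by (simp only: *)
qed

section \<open>The exponential moment of one step\<close>

lemma axis_in_unit_steps: "axis k 1 \<in> unit_steps" "- axis k 1 \<in> unit_steps"
  by (auto simp: unit_steps_def axis_def if_distrib cong: if_cong)

lemma unit_steps_cases:
  assumes "e \<in> unit_steps"
  shows "e $ k = 0 \<or> e = axis k 1 \<or> e = - axis k 1"
proof (cases "e $ k = 0")
  case False
  have *: "\<bar>e $ k\<bar> + (\<Sum>i\<in>UNIV - {k}. \<bar>e $ i\<bar>) = 1"
    using assms by (simp add: unit_steps_def sum.remove[of UNIV k])
  have "0 \<le> (\<Sum>i\<in>UNIV - {k}. \<bar>e $ i\<bar>)" by (intro sum_nonneg) auto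
  with * False have 1: "\<bar>e $ k\<bar> = 1" and "(\<Sum>i\<in>UNIV - {k}. \<bar>e $ i\<bar>) = 0" by linarith+
  then have "e $ i = 0" if "i \<noteq> k" for i
    using that by (subst (asm) sum_nonneg_eq_0_iff) auto
  then have "e = axis k (e $ k)" by (auto simp: vec_eq_iff axis_def)
  moreover have "e $ k = 1 \<or> e $ k = -1" using 1 by linarith
  moreover have "axis k (-1) = - axis k (1 :: int)" by (auto simp: vec_eq_iff axis_def)
  ultimately show ?thesis by metis
qed simp

text \<open>Subtracting the total mass \<open>1\<close> leaves only the two steps along
  \<open>k\<close>, whose contributions combine by
  \<open>(q - 1) + (1 / q - 1) * q\<^sup>2 = - (1 - q)\<^sup>2\<close>.\<close>

lemma sum_exponential_step:
  fixes \<omega> :: "'d::finite env"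
  assumes \<omega>: "\<omega> \<in> space env_space" and "q \<noteq> 0"
    and ratio: "\<omega> y (- axis k 1) = q\<^sup>2 * \<omega> y (axis k 1)"
  shows "(\<Sum>e\<in>unit_steps. q powi (e $ k) * \<omega> y e) = 1 - (1 - q)\<^sup>2 * \<omega> y (axis k 1)"
proof -
  have ne: "axis k 1 \<noteq> - axis k (1 :: int)"
    by (auto simp: vec_eq_iff axis_def)
  have "(\<Sum>e\<in>unit_steps. q powi (e $ k) * \<omega> y e) - 1 = (\<Sum>e\<in>unit_steps. (q powi (e $ k) - 1) * \<omega> y e)"
    by (simp add: left_diff_distrib sum_subtractf space_env_spaceD(2)[OF \<omega>])
  also have "\<dots> = (\<Sum>e\<in>{axis k 1, - axis k 1}. (q powi (e $ k) - 1) * \<omega> y e)"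
  proof (intro sum.mono_neutral_right finite_unit_steps ballI)
    fix e assume "e \<in> unit_steps - {axis k 1, - axis k 1}"
    then have "e $ k = 0" using unit_steps_cases[of e k] by blast
    then show "(q powi (e $ k) - 1) * \<omega> y e = 0" by simp
  qed (simp add: axis_in_unit_steps)
  also have "\<dots> = - ((1 - q)\<^sup>2 * \<omega> y (axis k 1))"
    using ne \<open>q \<noteq> 0\<close> by (simp add: ratio power_int_minus field_simps power2_eq_square)
  finally show ?thesis by simp
qed

section \<open>Stopped histories and the locality of weights\<close>

text \<open>The history stopped at the exit from \<open>A\<close>: the most recent site comes first,
  so leading entries are dropped until only sites of \<open>A\<close> lie behind the head. The exit
  site itself is kept.\<close>

primrec stop :: "'a set \<Rightarrow> 'a list \<Rightarrow> 'a list" where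
  "stop A [] = []"
| "stop A (y # h) = (if set h \<subseteq> A then y # h else stop A h)"

text \<open>\<open>tl h\<close> holds the sites already left. The environment at \<open>hd h\<close>
  is thus charged only when the next step uses it, and a revisit is not charged again.\<close>

definition potential :: "'d \<Rightarrow> real \<Rightarrow> real \<Rightarrow> (int ^ 'd::finite) list \<Rightarrow> real" where
  "potential k q \<rho> h = q powi (hd h $ k) / \<rho> ^ card (set (tl h))"

lemma stop_eq: "set (tl h) \<subseteq> A \<Longrightarrow> stop A h = h"
  by (cases h) auto

lemma hd_stop_mem: "h \<noteq> [] \<Longrightarrow> hd (stop A h) \<in> set h"
proof (induction h)
  case (Cons y h)
  then show ?case by (cases "h = []") auto
qed simp

text \<open>Dropping recent entries leaves a possibly shorter history, so bounds valid for histories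
  of every length apply to stopped ones.\<close>

lemma stop_mem_histories:
  assumes "h \<in> histories x n"
  shows "\<exists>m. stop A h \<in> histories x m"
  using assms
proof (induction n arbitrary: h)
  case 0
  then show ?case by (auto intro: exI[of _ 0])
next
  case (Suc n)
  from Suc.prems obtain g e where h: "h = (hd g + e) # g" "g \<in> histories x n" by auto
  show ?case
  proof (cases "set g \<subseteq> A")
    case True
    then show ?thesis using Suc.prems h by (metis stop.simps(2))
  next
    case False
    then have "stop A h = stop A g" unfolding h(1) by simp
    then show ?thesis using Suc.IH[OF h(2)] by simp
  qed
qed

lemma stop_history:
  assumes "m \<le> n" "X m \<notin> A" "\<And>i. i < m \<Longrightarrow> X i \<in> A"
  shows "stop A (history X n) = history X m"
  using assms(1)
proof (induction rule: dec_induct)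
  case base
  then show ?case
    using assms(3) by (cases m) (auto simp: set_history)
next
  case (step n)
  then have "\<not> set (history X n) \<subseteq> A"
    using assms(2) by (auto simp: set_history)
  then show ?case using step by simp
qed

lemma measurable_transition:
  assumes "e \<in> unit_steps"
  shows "(\<lambda>p. p e) \<in> borel_measurable site_space"
  unfolding site_space_def
  by (rule measurable_restrict_space1, rule measurable_component_singleton) (rule assms)

text \<open>The transition out of \<open>hd h\<close> is not part of the weight, so only the
  environment on \<open>set (tl h)\<close> enters. Together with \<open>weight_restrict\<close> this
  turns freshness of a site into independence.\<close>

lemma weight_measurable:
  assumes "h \<in> histories x n" "set (tl h) \<subseteq> A"
  shows "(\<lambda>\<omega>. weight \<omega> h) \<in> borel_measurable (\<Pi>\<^sub>M y\<in>A. site_space)"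
  using assms
proof (induction n arbitrary: h)
  case (Suc n)
  then obtain g e where h: "h = (hd g + e) # g" "g \<in> histories x n" "e \<in> unit_steps" by auto
  have g: "g \<noteq> []" using histories_nonempty h(2) .
  have "set g \<subseteq> A" using Suc.prems h by auto
  then have "hd g \<in> A" "set (tl g) \<subseteq> A" using g by (cases g; auto)+
  note [measurable] = Suc.IH[OF h(2) this(2)]
  have "(\<lambda>\<omega>. \<omega> (hd g)) \<in> (\<Pi>\<^sub>M y\<in>A. site_space) \<rightarrow>\<^sub>M site_space"
    by (rule measurable_component_singleton) fact
  then have [measurable]: "(\<lambda>\<omega>. \<omega> (hd g) e) \<in> borel_measurable (\<Pi>\<^sub>M y\<in>A. site_space)"
    using measurable_transition[OF h(3)] by (rule measurable_compose)
  show ?case by (simp add: h(1) g)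
qed simp

lemma weight_restrict:
  assumes "set (tl h) \<subseteq> A"
  shows "weight (restrict \<omega> A) h = weight \<omega> h"
  using assms
proof (induction h)
  case (Cons y h)
  then show ?case by (cases h) auto
qed simp

section \<open>The annealed supermartingale\<close>

locale biased_iid_env = prob_space \<PP> for \<PP> :: "'d::finite env measure" +
  fixes k :: 'd and q :: real
  assumes sets_env: "sets \<PP> = sets env_space"
    and iid: "iid_env \<PP>"
    and elliptic: "elliptic \<PP>"
    and q: "0 < q" "q < 1"
    and ratio_0: "AE \<omega> in \<PP>. \<omega> 0 (- axis k 1) = q\<^sup>2 * \<omega> 0 (axis k 1)"
begin

definition mean_step :: real where
  "mean_step = expectation (\<lambda>\<omega>. \<omega> 0 (axis k 1))"

definition rate :: real where
  "rate = 1 - (1 - q)\<^sup>2 * mean_step"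

lemma space_env: "space \<PP> = space env_space"
  using sets_env by (rule sets_eq_imp_space_eq)

lemma measurable_site: "(\<lambda>\<omega>. \<omega> y) \<in> \<PP> \<rightarrow>\<^sub>M site_space"
  unfolding measurable_cong_sets[OF sets_env refl] env_space_def
  by (rule measurable_component_singleton) simp

lemma measurable_env: "e \<in> unit_steps \<Longrightarrow> (\<lambda>\<omega>. \<omega> y e) \<in> borel_measurable \<PP>"
  using measurable_site measurable_transition by (rule measurable_compose)

lemma distr_site: "distr \<PP> site_space (\<lambda>\<omega>. \<omega> y) = distr \<PP> site_space (\<lambda>\<omega>. \<omega> 0)"
  using iid by (auto simp: iid_env_def)

text \<open>Identical distribution carries the ratio from the origin to every site, and countability
  of the lattice merges the null sets into one.\<close>

lemma AE_ratio: "AE \<omega> in \<PP>. \<forall>y. \<omega> y (- axis k 1) = q\<^sup>2 * \<omega> y (axis k 1)"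
proof -
  have meas: "{p\<in>space site_space. p (- axis k 1) = q\<^sup>2 * p (axis k 1)} \<in> sets site_space"
    by (intro measurable_equality_set borel_measurable_times borel_measurable_const measurable_transition
        axis_in_unit_steps)
  have "AE \<omega> in \<PP>. \<omega> y (- axis k 1) = q\<^sup>2 * \<omega> y (axis k 1)" for y
    using ratio_0 unfolding AE_distr_iff[OF measurable_site meas, symmetric] distr_site[of y] .
  then show ?thesis by (simp add: AE_all_countable)
qed

lemma env_nonneg: "\<omega> \<in> space \<PP> \<Longrightarrow> e \<in> unit_steps \<Longrightarrow> 0 \<le> \<omega> y e"
  using space_env_spaceD(1) by (simp add: space_env)

lemma env_le_1:
  assumes "\<omega> \<in> space \<PP>" "e \<in> unit_steps"
  shows "\<omega> y e \<le> 1"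
proof -
  have "\<omega> y e \<le> (\<Sum>e\<in>unit_steps. \<omega> y e)"
    using assms env_nonneg by (intro member_le_sum finite_unit_steps) auto
  then show ?thesis using space_env_spaceD(2)[of \<omega>] assms by (simp add: space_env)
qed

lemma integrable_env: "e \<in> unit_steps \<Longrightarrow> integrable \<PP> (\<lambda>\<omega>. \<omega> y e)"
  using env_nonneg env_le_1 by (intro integrable_const_bound[of _ 1] AE_I2 measurable_env) auto

lemma expectation_env: "expectation (\<lambda>\<omega>. \<omega> y (axis k 1)) = mean_step"
proof -
  note [measurable] = measurable_transition[OF axis_in_unit_steps(1)] measurable_site
  have "expectation (\<lambda>\<omega>. \<omega> y (axis k 1)) = integral\<^sup>L (distr \<PP> site_space (\<lambda>\<omega>. \<omega> y)) (\<lambda>p. p (axis k 1))" for y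
    by (subst integral_distr) auto
  from this[of y] this[of 0] show ?thesis by (simp only: mean_step_def distr_site[of y])
qed

text \<open>A nonnegative variable of mean \<open>0\<close> vanishes almost surely, which
  ellipticity forbids. This strict positivity is what makes \<open>rate < 1\<close>.\<close>

lemma mean_step_pos: "0 < mean_step"
proof -
  have pos: "AE \<omega> in \<PP>. 0 < \<omega> 0 (axis k 1)"
    using elliptic axis_in_unit_steps by (auto simp: elliptic_def)
  have "0 \<le> mean_step"
    unfolding mean_step_def using pos by (intro integral_nonneg_AE) auto
  moreover have "mean_step \<noteq> 0"
  proof
    assume "mean_step = 0"
    then have "AE \<omega> in \<PP>. \<omega> 0 (axis k 1) = 0"
      unfolding mean_step_def
      by (subst (asm) integral_nonneg_eq_0_iff_AE) (use pos in \<open>auto intro: integrable_env axis_in_unit_steps\<close>)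
    with pos have "AE \<omega> in \<PP>. False" by eventually_elim simp
    then show False by simp
  qed
  ultimately show ?thesis by simp
qed

lemma mean_step_le_1: "mean_step \<le> 1"
  unfolding mean_step_def
  by (rule integral_le_const) (auto intro!: integrable_env axis_in_unit_steps AE_I2 env_le_1)

lemma rate: "0 < rate" "rate < 1"
proof -
  have "(1 - q)\<^sup>2 * mean_step \<le> (1 - q)\<^sup>2"
    using mult_left_mono[OF mean_step_le_1, of "(1 - q)\<^sup>2"] by simp
  moreover have "(1 - q)\<^sup>2 < 1"
    using q by (simp add: power_less_one_iff)
  ultimately have "(1 - q)\<^sup>2 * mean_step < 1" by simp
  then show "0 < rate" by (simp add: rate_def)
  show "rate < 1" using q mean_step_pos by (simp add: rate_def)
qed

lemma measurable_weight: "h \<in> histories x n \<Longrightarrow> (\<lambda>\<omega>. weight \<omega> h) \<in> borel_measurable \<PP>"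
  unfolding measurable_cong_sets[OF sets_env refl] env_space_def
  by (rule weight_measurable) auto

lemma integrable_weight: "h \<in> histories x n \<Longrightarrow> integrable \<PP> (\<lambda>\<omega>. weight \<omega> h)"
  using weight_nonneg[of _ h x n] weight_le_1[of _ h x n]
  by (intro integrable_const_bound[of _ 1] AE_I2 measurable_weight) (simp_all add: space_env)

lemma integrable_weight_env:
  assumes "h \<in> histories x n" "e \<in> unit_steps"
  shows "integrable \<PP> (\<lambda>\<omega>. weight \<omega> h * \<omega> y e)"
proof (rule integrable_const_bound[of _ 1])
  show "AE \<omega> in \<PP>. norm (weight \<omega> h * \<omega> y e) \<le> 1"
    using weight_nonneg[OF _ assms(1)] weight_le_1[OF _ assms(1)] env_nonneg env_le_1 assms
    by (intro AE_I2) (auto simp: abs_mult space_env intro!: mult_le_one)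
  show "(\<lambda>\<omega>. weight \<omega> h * \<omega> y e) \<in> borel_measurable \<PP>"
    by (intro borel_measurable_times measurable_weight[OF assms(1)] measurable_env assms(2))
qed

text \<open>The weight is a function of the environment on \<open>set (tl h)\<close>, which is
  independent of the environment at a site outside that set.\<close>

lemma expectation_weight_fresh:
  assumes h: "h \<in> histories x n" and y: "y \<notin> set (tl h)"
  shows "expectation (\<lambda>\<omega>. weight \<omega> h * \<omega> y (axis k 1)) = expectation (\<lambda>\<omega>. weight \<omega> h) * mean_step"
proof -
  let ?A = "set (tl h)"
  have "indep_vars (\<lambda>_. site_space) (\<lambda>x \<omega>. \<omega> x) UNIV"
    using iid by (simp add: iid_env_def)
  from indep_var_restrict[OF this, of ?A "{y}"] y
  have "indep_var (PiM ?A (\<lambda>_. site_space)) (\<lambda>\<omega>. restrict \<omega> ?A) (PiM {y} (\<lambda>_. site_space)) (\<lambda>\<omega>. restrict \<omega> {y})"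
    by simp
  moreover have "(\<lambda>\<omega>. \<omega> y) \<in> PiM {y} (\<lambda>_. site_space) \<rightarrow>\<^sub>M (site_space :: (int ^ 'd \<Rightarrow> real) measure)"
    by (rule measurable_component_singleton) simp
  ultimately have "indep_var borel ((\<lambda>\<omega>. weight \<omega> h) \<circ> (\<lambda>\<omega>. restrict \<omega> ?A)) borel ((\<lambda>\<omega>. \<omega> y (axis k 1)) \<circ> (\<lambda>\<omega>. restrict \<omega> {y}))"
    by (intro indep_var_compose[OF _ weight_measurable[OF h order.refl]]
      measurable_compose[OF _ measurable_transition[OF axis_in_unit_steps(1)]])
  then have "indep_var borel (\<lambda>\<omega>. weight \<omega> h) borel (\<lambda>\<omega>. \<omega> y (axis k 1))"
    by (simp add: comp_def weight_restrict)
  then show ?thesis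
    by (subst indep_var_lebesgue_integral)
      (auto intro: integrable_weight[OF h] integrable_env axis_in_unit_steps simp: expectation_env)
qed

text \<open>Summing over \<open>e\<close> puts the factor
  \<open>1 - (1 - q)\<^sup>2 * \<omega> (hd h) (axis k 1)\<close> under the expectation. On a
  revisit it is at most \<open>1\<close> and the count of sites is unchanged; at a fresh site
  independence yields exactly \<open>rate\<close>, which cancels the additional power of
  \<open>rate\<close> in the denominator.\<close>

lemma annealed_step:
  assumes h: "h \<in> histories x n"
  shows "(\<Sum>e\<in>unit_steps. potential k q rate ((hd h + e) # h) * expectation (\<lambda>\<omega>. weight \<omega> h * \<omega> (hd h) e))
    \<le> potential k q rate h * expectation (\<lambda>\<omega>. weight \<omega> h)"
proof -
  let ?E = "expectation (\<lambda>\<omega>. weight \<omega> h * (1 - (1 - q)\<^sup>2 * \<omega> (hd h) (axis k 1)))"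
  let ?Q = "q powi (hd h $ k)"
  have "?E = expectation (\<lambda>\<omega>. \<Sum>e\<in>unit_steps. q powi (e $ k) * (weight \<omega> h * \<omega> (hd h) e))"
  proof (rule integral_cong_AE)
    show "AE \<omega> in \<PP>. weight \<omega> h * (1 - (1 - q)\<^sup>2 * \<omega> (hd h) (axis k 1)) =
        (\<Sum>e\<in>unit_steps. q powi (e $ k) * (weight \<omega> h * \<omega> (hd h) e))"
      using AE_ratio AE_space
    proof eventually_elim
      case (elim \<omega>)
      then show ?case
        using q by (subst sum_exponential_step[symmetric]) (auto simp: space_env sum_distrib_left ac_simps)
    qed
  qed (intro borel_measurable_times borel_measurable_diff borel_measurable_sum borel_measurable_const
      measurable_weight[OF h] measurable_env axis_in_unit_steps; assumption)+
  also have "\<dots> = (\<Sum>e\<in>unit_steps. q powi (e $ k) * expectation (\<lambda>\<omega>. weight \<omega> h * \<omega> (hd h) e))"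
    using integrable_weight_env[OF h] by simp
  finally have E: "(\<Sum>e\<in>unit_steps. q powi (e $ k) * expectation (\<lambda>\<omega>. weight \<omega> h * \<omega> (hd h) e)) = ?E" ..
  \<comment> \<open>The tail of the extended history is \<open>h\<close> for every \<open>e\<close>,
    so the denominator comes out of the sum.\<close>
  have "(\<Sum>e\<in>unit_steps. potential k q rate ((hd h + e) # h) * expectation (\<lambda>\<omega>. weight \<omega> h * \<omega> (hd h) e)) =
      ?Q / rate ^ card (set h) * ?E"
    unfolding E[symmetric] sum_distrib_left
    using q by (intro sum.cong) (simp_all add: potential_def power_int_add)
  also have "\<dots> \<le> ?Q / rate ^ card (set (tl h)) * expectation (\<lambda>\<omega>. weight \<omega> h)"
  proof (cases "hd h \<in> set (tl h)")
    case True
    then have "set h = set (tl h)"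
      using histories_nonempty[OF h] by (cases h) auto
    moreover have "?E \<le> expectation (\<lambda>\<omega>. weight \<omega> h)"
    proof (rule integral_mono)
      show "integrable \<PP> (\<lambda>\<omega>. weight \<omega> h * (1 - (1 - q)\<^sup>2 * \<omega> (hd h) (axis k 1)))"
        using integrable_weight[OF h] integrable_weight_env[OF h axis_in_unit_steps(1)]
        by (simp add: right_diff_distrib mult.left_commute[of "weight _ _"])
      show "weight \<omega> h * (1 - (1 - q)\<^sup>2 * \<omega> (hd h) (axis k 1)) \<le> weight \<omega> h" if "\<omega> \<in> space \<PP>" for \<omega>
        using that weight_nonneg[OF _ h] env_nonneg[OF that axis_in_unit_steps(1)]
        by (simp add: space_env right_diff_distrib)
    qed (rule integrable_weight[OF h])
    ultimately show ?thesis
      using q rate by (simp only:) (intro mult_left_mono; simp)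
  next
    case False
    then have "card (set h) = Suc (card (set (tl h)))"
      using histories_nonempty[OF h] by (cases h) auto
    moreover have "?E = expectation (\<lambda>\<omega>. weight \<omega> h) * rate"
      using integrable_weight[OF h] integrable_weight_env[OF h axis_in_unit_steps(1)]
      by (simp add: right_diff_distrib mult.left_commute[of "weight _ _"] expectation_weight_fresh[OF h False] rate_def)
    ultimately show ?thesis using rate by simp
  qed
  finally show ?thesis by (simp add: potential_def)
qed

text \<open>The sum starts at \<open>1\<close> and cannot increase: inside \<open>A\<close> by
  \<open>annealed_step\<close>, and after the exit because the stopped history is frozen while the
  transition probabilities sum to \<open>1\<close>.\<close>

lemma annealed_supermartingale:
  "(\<Sum>h\<in>histories 0 n. potential k q rate (stop A h) * expectation (\<lambda>\<omega>. weight \<omega> h)) \<le> 1"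
proof (induction n)
  case 0
  then show ?case by (simp add: potential_def prob_space)
next
  case (Suc n)
  let ?f = "\<lambda>h. potential k q rate (stop A h)"
  have "(\<Sum>h\<in>histories 0 (Suc n). ?f h * expectation (\<lambda>\<omega>. weight \<omega> h)) =
    (\<Sum>h\<in>histories 0 n. \<Sum>e\<in>unit_steps. ?f ((hd h + e) # h) * expectation (\<lambda>\<omega>. weight \<omega> h * \<omega> (hd h) e))"
    unfolding sum_histories_Suc
    by (intro sum.cong refl) (simp add: histories_nonempty weight_Cons del: weight.simps stop.simps)
  also have "\<dots> \<le> (\<Sum>h\<in>histories 0 n. ?f h * expectation (\<lambda>\<omega>. weight \<omega> h))"
  proof (rule sum_mono)
    fix h :: "(int ^ 'd) list" assume h: "h \<in> histories 0 n"
    show "(\<Sum>e\<in>unit_steps. ?f ((hd h + e) # h) * expectation (\<lambda>\<omega>. weight \<omega> h * \<omega> (hd h) e)) \<le>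
      ?f h * expectation (\<lambda>\<omega>. weight \<omega> h)"
    proof (cases "set h \<subseteq> A")
      case True
      then have "set (tl h) \<subseteq> A" by (cases h) auto
      then show ?thesis using annealed_step[OF h] True by (simp add: stop_eq)
    next
      case False
      have "(\<Sum>e\<in>unit_steps. ?f ((hd h + e) # h) * expectation (\<lambda>\<omega>. weight \<omega> h * \<omega> (hd h) e)) =
          ?f h * (\<Sum>e\<in>unit_steps. expectation (\<lambda>\<omega>. weight \<omega> h * \<omega> (hd h) e))"
        using False by (simp add: sum_distrib_left)
      also have "(\<Sum>e\<in>unit_steps. expectation (\<lambda>\<omega>. weight \<omega> h * \<omega> (hd h) e)) =
          expectation (\<lambda>\<omega>. weight \<omega> h * (\<Sum>e\<in>unit_steps. \<omega> (hd h) e))"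
        using integrable_weight_env[OF h] by (simp add: sum_distrib_left)
      also have "\<dots> = expectation (\<lambda>\<omega>. weight \<omega> h)"
        by (rule Bochner_Integration.integral_cong) (auto simp: space_env space_env_spaceD(2))
      finally show ?thesis by simp
    qed
  qed
  finally show ?case using Suc by simp
qed

end

section \<open>Counting distinct sites, and quenched exit from a finite set\<close>

text \<open>A discrete intermediate value argument: the l1 norm starts at \<open>0\<close> and grows
  by at most \<open>1\<close> per step, so every integer below its final value is attained at an
  earlier site, and sites with distinct norms are distinct.\<close>

lemma l1_norm_le_card:
  assumes "h \<in> histories 0 n"
  shows "(\<Sum>i\<in>UNIV. \<bar>hd h $ i\<bar>) \<le> int (card (set (tl h)))"
proof -
  define N :: "int ^ 'a \<Rightarrow> int" where "N y = (\<Sum>i\<in>UNIV. \<bar>y $ i\<bar>)" for y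
  have "{0..<N (hd h)} \<subseteq> N ` set (tl h)"
    using assms
  proof (induction n arbitrary: h)
    case 0
    then show ?case by (simp add: N_def)
  next
    case (Suc n)
    then obtain g e where h: "h = (hd g + e) # g" "g \<in> histories 0 n" "e \<in> unit_steps" by auto
    have "N (hd g + e) \<le> N (hd g) + N e"
      unfolding N_def sum.distrib[symmetric] by (intro sum_mono) auto
    also have "N e = 1" using h(3) by (simp add: N_def unit_steps_def)
    finally have "{0..<N (hd h)} \<subseteq> insert (N (hd g)) {0..<N (hd g)}" unfolding h(1) by auto
    also have "\<dots> \<subseteq> insert (N (hd g)) (N ` set (tl g))" using Suc.IH[OF h(2)] by auto
    also have "\<dots> \<subseteq> N ` set g" using histories_nonempty[OF h(2)] by (cases g) auto
    finally show ?case by (simp add: h(1))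
  qed
  then have "card {0..<N (hd h)} \<le> card (N ` set (tl h))" by (intro card_mono) auto
  also have "\<dots> \<le> card (set (tl h))" by (rule card_image_le) simp
  finally show ?thesis by (simp add: N_def)
qed

lemma finite_positive_lower_bound:
  fixes f :: "'a \<Rightarrow> real"
  assumes "finite A" "\<And>y. y \<in> A \<Longrightarrow> 0 < f y"
  obtains c where "0 < c" "c \<le> 1" "\<And>y. y \<in> A \<Longrightarrow> c \<le> f y"
proof
  \<comment> \<open>Inserting \<open>1\<close> gives the bound \<open>c \<le> 1\<close> and keeps
    the minimum meaningful when \<open>A\<close> is empty.\<close>
  show "0 < Min (insert 1 (f ` A))" using assms by (subst Min_gr_iff) auto
qed (use assms in \<open>auto intro: Min_le\<close>)

text \<open>In a fixed environment every visit to \<open>A\<close>, fresh or not, gains the factor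
  \<open>1 - \<delta>\<close>; walks that step out of \<open>A\<close> are dropped from the
  sum.\<close>

lemma quenched_stay_decay:
  fixes \<omega> :: "'d::finite env"
  assumes \<omega>: "\<omega> \<in> space env_space" and "0 < q" and "\<delta> \<le> 1"
    and ratio: "\<And>y. \<omega> y (- axis k 1) = q\<^sup>2 * \<omega> y (axis k 1)"
    and \<delta>: "\<And>y. y \<in> A \<Longrightarrow> \<delta> \<le> (1 - q)\<^sup>2 * \<omega> y (axis k 1)"
  shows "(\<Sum>h\<in>histories x n. of_bool (set h \<subseteq> A) * (q powi (hd h $ k) * weight \<omega> h)) \<le> q powi (x $ k) * (1 - \<delta>) ^ n"
proof (induction n)
  case 0
  then show ?case using \<open>0 < q\<close> by simp
next
  case (Suc n)
  let ?S = "\<lambda>n. \<Sum>h\<in>histories x n. of_bool (set h \<subseteq> A) * (q powi (hd h $ k) * weight \<omega> h)"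
  have "?S (Suc n) \<le> (\<Sum>h\<in>histories x n. of_bool (set h \<subseteq> A) * (q powi (hd h $ k) * weight \<omega> h) * (1 - \<delta>))"
    unfolding sum_histories_Suc
  proof (rule sum_mono)
    fix h :: "(int ^ 'd) list" assume h: "h \<in> histories x n"
    note ne = histories_nonempty[OF h]
    let ?c = "of_bool (set h \<subseteq> A) * (q powi (hd h $ k) * weight \<omega> h)"
    have c: "0 \<le> ?c" using weight_nonneg[OF \<omega> h] \<open>0 < q\<close> by simp
    have "(\<Sum>e\<in>unit_steps. of_bool (set ((hd h + e) # h) \<subseteq> A) *
        (q powi (hd ((hd h + e) # h) $ k) * weight \<omega> ((hd h + e) # h))) \<le>
      (\<Sum>e\<in>unit_steps. ?c * (q powi (e $ k) * \<omega> (hd h) e))"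
    proof (rule sum_mono)
      fix e :: "int ^ 'd" assume e: "e \<in> unit_steps"
      \<comment> \<open>A step out of \<open>A\<close> contributes \<open>0\<close> on the left, so
        removing its indicator only adds a nonnegative term.\<close>
      have "0 \<le> ?c * (q powi (e $ k) * \<omega> (hd h) e)"
        using c \<open>0 < q\<close> space_env_spaceD(1)[OF \<omega> e] by simp
      then show "of_bool (set ((hd h + e) # h) \<subseteq> A) *
          (q powi (hd ((hd h + e) # h) $ k) * weight \<omega> ((hd h + e) # h)) \<le> ?c * (q powi (e $ k) * \<omega> (hd h) e)"
        using \<open>0 < q\<close> ne by (cases "hd h + e \<in> A") (auto simp: power_int_add mult.assoc mult.left_commute)
    qed
    also have "\<dots> = ?c * (1 - (1 - q)\<^sup>2 * \<omega> (hd h) (axis k 1))"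
      using \<open>0 < q\<close> by (simp add: sum_distrib_left[symmetric] sum_exponential_step[OF \<omega> _ ratio])
    also have "\<dots> \<le> ?c * (1 - \<delta>)"
    proof (cases "set h \<subseteq> A")
      case True
      then have "hd h \<in> A" using ne by auto
      then show ?thesis using \<delta> by (intro mult_left_mono c) simp
    qed simp
    finally show "(\<Sum>e\<in>unit_steps. of_bool (set ((hd h + e) # h) \<subseteq> A) *
        (q powi (hd ((hd h + e) # h) $ k) * weight \<omega> ((hd h + e) # h))) \<le> ?c * (1 - \<delta>)" .
  qed
  also have "\<dots> = ?S n * (1 - \<delta>)" by (rule sum_distrib_right[symmetric])
  also have "\<dots> \<le> q powi (x $ k) * (1 - \<delta>) ^ n * (1 - \<delta>)"
    using Suc \<open>\<delta> \<le> 1\<close> by (intro mult_right_mono) auto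
  finally show ?case by (simp add: ac_simps)
qed

text \<open>On a finite \<open>A\<close> both the gain \<open>\<delta>\<close> and the values
  \<open>q powi (y $ k)\<close> are bounded below by positive constants, so the probability of
  staying up to time \<open>n\<close> decays geometrically.\<close>

lemma emeasure_quenched_stay:
  fixes \<omega> :: "'d::finite env"
  assumes \<omega>: "\<omega> \<in> space env_space" and q: "0 < q" "q < 1" and "finite A"
    and ratio: "\<And>y. \<omega> y (- axis k 1) = q\<^sup>2 * \<omega> y (axis k 1)"
    and pos: "\<And>y. 0 < \<omega> y (axis k 1)"
  shows "emeasure (quenched_law \<omega> x) {X. \<forall>i. X i \<in> A} = 0"
proof -
  obtain \<delta> where \<delta>: "0 < \<delta>" "\<delta> \<le> 1" "\<And>y. y \<in> A \<Longrightarrow> \<delta> \<le> (1 - q)\<^sup>2 * \<omega> y (axis k 1)"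
    using finite_positive_lower_bound[OF \<open>finite A\<close>, of "\<lambda>y. (1 - q)\<^sup>2 * \<omega> y (axis k 1)"] q pos by auto
  obtain c where c: "0 < c" "\<And>y. y \<in> A \<Longrightarrow> c \<le> q powi (y $ k)"
    using finite_positive_lower_bound[OF \<open>finite A\<close>, of "\<lambda>y. q powi (y $ k)"] q by auto
  have le: "emeasure (quenched_law \<omega> x) {X. \<forall>i. X i \<in> A} \<le> ennreal (q powi (x $ k) / c * (1 - \<delta>) ^ n)" for n
  proof -
    have "emeasure (quenched_law \<omega> x) {X. \<forall>i. X i \<in> A} \<le> emeasure (quenched_law \<omega> x) {X. set (history X n) \<subseteq> A}"
      using sets_history[of "\<lambda>h. set h \<subseteq> A" n]
      by (intro emeasure_mono) (auto simp: set_history sets_quenched_law[OF \<omega>])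
    also have "\<dots> = ennreal (\<Sum>h\<in>{h\<in>histories x n. set h \<subseteq> A}. weight \<omega> h)"
      by (rule emeasure_quenched_law_history_pred[OF \<omega>])
    also have "\<dots> \<le> ennreal (q powi (x $ k) / c * (1 - \<delta>) ^ n)"
    proof (rule ennreal_leI)
      have "c * (\<Sum>h\<in>{h\<in>histories x n. set h \<subseteq> A}. weight \<omega> h) =
          (\<Sum>h\<in>histories x n. of_bool (set h \<subseteq> A) * (c * weight \<omega> h))"
        unfolding sum_distrib_left by (intro sum.mono_neutral_cong_left) (auto simp: finite_histories)
      also have "\<dots> \<le> (\<Sum>h\<in>histories x n. of_bool (set h \<subseteq> A) * (q powi (hd h $ k) * weight \<omega> h))"
        by (intro sum_mono) (auto intro!: mult_right_mono c(2) weight_nonneg[OF \<omega>] simp: histories_nonempty subset_iff)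
      also have "\<dots> \<le> q powi (x $ k) * (1 - \<delta>) ^ n"
        by (rule quenched_stay_decay[OF \<omega> q(1) \<delta>(2) ratio \<delta>(3)])
      finally show "(\<Sum>h\<in>{h\<in>histories x n. set h \<subseteq> A}. weight \<omega> h) \<le> q powi (x $ k) / c * (1 - \<delta>) ^ n"
        using c(1) by (simp add: field_simps)
    qed
    finally show ?thesis .
  qed
  have "(\<lambda>n. q powi (x $ k) / c * (1 - \<delta>) ^ n) \<longlonglongrightarrow> q powi (x $ k) / c * 0"
    using \<delta> by (intro tendsto_mult tendsto_const LIMSEQ_power_zero) auto
  then have "(\<lambda>n. ennreal (q powi (x $ k) / c * (1 - \<delta>) ^ n)) \<longlonglongrightarrow> ennreal 0"
    by (intro tendsto_ennrealI) simp
  from LIMSEQ_le_const[OF this, of "emeasure (quenched_law \<omega> x) {X. \<forall>i. X i \<in> A}"] le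
  show ?thesis by (auto simp: le_zero_eq)
qed

text \<open>The index \<open>j\<close> excludes an infinite exit time, for which
  \<open>bad_exit\<close> holds vacuously; the infimum is then attained at the first time outside
  \<open>A\<close>.\<close>

lemma bad_exitD:
  assumes "X \<in> bad_exit A l L" "X j \<notin> A"
  obtains n where "X n \<notin> A" "\<And>i. i < n \<Longrightarrow> X i \<in> A" "real_vec (X n) \<bullet> l < L"
proof -
  define m where "m = (LEAST n. X n \<notin> A)"
  have m: "X m \<notin> A" "\<And>n. X n \<notin> A \<Longrightarrow> m \<le> n"
    unfolding m_def using LeastI[of "\<lambda>n. X n \<notin> A", OF assms(2)] by (auto intro: Least_le)
  have "exit_time A X = enat m"
    unfolding exit_time_def
    by (intro antisym INF_lower2[of m] INF_greatest) (use m in auto)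
  then have "real_vec (X m) \<bullet> l < L" using assms(1) by (simp add: bad_exit_def)
  with m show thesis by (intro that[of m]) (auto simp: not_le[symmetric])
qed

section \<open>The annealed probability of a bad exit\<close>

context biased_iid_env
begin

lemma sets_stay: "{X. \<forall>i. X i \<in> A} \<in> sets (path_space :: (nat \<Rightarrow> int ^ 'd) measure)"
proof -
  have "{X. \<forall>i. X i \<in> A} = (\<Inter>n. {X. set (history X n) \<subseteq> A})"
    by (auto simp: set_history)
  also have "\<dots> \<in> sets path_space"
    by (intro sets.countable_INT') (auto intro: sets_history)
  finally show ?thesis .
qed

text \<open>Disposes of the paths that \<open>bad_exit\<close> counts without an exit. The quenched
  decay depends on \<open>\<omega>\<close>, but its limit is \<open>0\<close> for almost every
  environment, and this integrates to \<open>0\<close>.\<close>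

lemma emeasure_annealed_stay:
  assumes "finite A"
  shows "emeasure (annealed_law \<PP> x) {X. \<forall>i. X i \<in> A} = 0"
proof -
  have "\<forall>y. AE \<omega> in \<PP>. 0 < \<omega> y (axis k 1)"
    using elliptic axis_in_unit_steps by (auto simp: elliptic_def)
  then have "AE \<omega> in \<PP>. \<forall>y. 0 < \<omega> y (axis k 1)"
    by (simp add: AE_all_countable)
  with AE_ratio AE_space have "AE \<omega> in \<PP>. emeasure (quenched_law \<omega> x) {X. \<forall>i. X i \<in> A} = 0"
    by eventually_elim (rule emeasure_quenched_stay[OF _ q assms], auto simp: space_env)
  then show ?thesis
    by (simp add: emeasure_annealed_law[OF prob_space_axioms sets_env sets_stay] cong: nn_integral_cong_AE)
qed

lemma emeasure_annealed_history:
  "emeasure (annealed_law \<PP> x) {X. P (history X n)} =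
    ennreal (\<Sum>h\<in>{h\<in>histories x n. P h}. expectation (\<lambda>\<omega>. weight \<omega> h))"
proof -
  have "emeasure (annealed_law \<PP> x) {X. P (history X n)} =
      (\<integral>\<^sup>+\<omega>. ennreal (\<Sum>h\<in>{h\<in>histories x n. P h}. weight \<omega> h) \<partial>\<PP>)"
    unfolding emeasure_annealed_law[OF prob_space_axioms sets_env sets_history]
    by (intro nn_integral_cong emeasure_quenched_law_history_pred) (simp add: space_env)
  also have "\<dots> = ennreal (expectation (\<lambda>\<omega>. \<Sum>h\<in>{h\<in>histories x n. P h}. weight \<omega> h))"
    by (intro nn_integral_eq_integral Bochner_Integration.integrable_sum AE_I2 sum_nonneg)
      (auto intro: integrable_weight weight_nonneg simp: space_env)
  also have "expectation (\<lambda>\<omega>. \<Sum>h\<in>{h\<in>histories x n. P h}. weight \<omega> h) =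
      (\<Sum>h\<in>{h\<in>histories x n. P h}. expectation (\<lambda>\<omega>. weight \<omega> h))"
    by (intro Bochner_Integration.integral_sum) (auto intro: integrable_weight)
  finally show ?thesis .
qed

lemma expectation_weight_nonneg: "h \<in> histories x n \<Longrightarrow> 0 \<le> expectation (\<lambda>\<omega>. weight \<omega> h)"
  by (intro Bochner_Integration.integral_nonneg) (auto simp: space_env intro: weight_nonneg)

lemma potential_nonneg: "0 \<le> potential k q rate h"
  using q rate by (simp add: potential_def)

text \<open>Markov's inequality for the stopped supermartingale bounds the probability of a bad exit
  by time \<open>n\<close> uniformly in \<open>n\<close>. Continuity from below removes
  \<open>n\<close>, and the paths that stay in \<open>A\<close> form a null set.\<close>

lemma emeasure_bad_exit_le:
  assumes "finite A" and "0 < \<theta>"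
    and \<theta>: "\<And>h n. h \<in> histories 0 n \<Longrightarrow> hd h \<notin> A \<Longrightarrow> real_vec (hd h) \<bullet> l < L \<Longrightarrow> \<theta> \<le> potential k q rate h"
  shows "emeasure (annealed_law \<PP> 0) (bad_exit A l L) \<le> ennreal (1 / \<theta>)"
proof -
  let ?bad = "\<lambda>h :: (int ^ 'd) list. hd (stop A h) \<notin> A \<and> real_vec (hd (stop A h)) \<bullet> l < L"
  let ?\<mu> = "annealed_law \<PP> 0"
  define E where "E n = {X. ?bad (history X n)}" for n
  have sets_\<mu>: "sets ?\<mu> = sets path_space"
    unfolding annealed_law_def
    using prob_space.not_empty[OF prob_space_axioms]
    by (intro sets_bind) (auto simp: sets_quenched_law space_env)
  have E_sets: "E n \<in> sets ?\<mu>" for n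
    unfolding E_def sets_\<mu> by (rule sets_history)
  have E_le: "emeasure ?\<mu> (E n) \<le> ennreal (1 / \<theta>)" for n
  proof -
    have "\<theta> * (\<Sum>h\<in>{h\<in>histories 0 n. ?bad h}. expectation (\<lambda>\<omega>. weight \<omega> h)) \<le>
        (\<Sum>h\<in>{h\<in>histories 0 n. ?bad h}. potential k q rate (stop A h) * expectation (\<lambda>\<omega>. weight \<omega> h))"
      unfolding sum_distrib_left
    proof (intro sum_mono mult_right_mono)
      fix h assume "h \<in> {h\<in>histories 0 n. ?bad h}"
      then show "\<theta> \<le> potential k q rate (stop A h)" "0 \<le> expectation (\<lambda>\<omega>. weight \<omega> h)"
        using stop_mem_histories[of h 0 n A] \<theta> by (auto intro: expectation_weight_nonneg)
    qed
    also have "\<dots> \<le> (\<Sum>h\<in>histories 0 n. potential k q rate (stop A h) * expectation (\<lambda>\<omega>. weight \<omega> h))"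
      by (intro sum_mono2 finite_histories) (auto intro!: mult_nonneg_nonneg expectation_weight_nonneg potential_nonneg)
    also have "\<dots> \<le> 1" by (rule annealed_supermartingale)
    finally show ?thesis
      using \<open>0 < \<theta>\<close> unfolding E_def emeasure_annealed_history[where P="?bad"] by (intro ennreal_leI) (simp add: field_simps)
  qed
  \<comment> \<open>A bad stopped history has already left \<open>A\<close>, so further steps do not
    change it.\<close>
  have "incseq E"
  proof (rule incseq_SucI)
    show "E n \<subseteq> E (Suc n)" for n
    proof
      fix X assume X: "X \<in> E n"
      then have "\<not> set (history X n) \<subseteq> A"
        using hd_stop_mem[OF history_nonempty, of A X n] by (auto simp: E_def)
      then show "X \<in> E (Suc n)" using X by (simp add: E_def)
    qed
  qed
  then have "emeasure ?\<mu> (\<Union>n. E n) = (SUP n. emeasure ?\<mu> (E n))"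
    using E_sets by (intro SUP_emeasure_incseq[symmetric]) auto
  also have "\<dots> \<le> ennreal (1 / \<theta>)" by (intro SUP_least E_le)
  finally have UN: "emeasure ?\<mu> (\<Union>n. E n) \<le> ennreal (1 / \<theta>)" .
  have "bad_exit A l L \<subseteq> (\<Union>n. E n) \<union> {X. \<forall>i. X i \<in> A}"
  proof
    fix X assume X: "X \<in> bad_exit A l L"
    show "X \<in> (\<Union>n. E n) \<union> {X. \<forall>i. X i \<in> A}"
    proof (cases "\<forall>i. X i \<in> A")
      case False
      then obtain j where "X j \<notin> A" by blast
      from bad_exitD[OF X this] obtain n where
        n: "X n \<notin> A" "\<And>i. i < n \<Longrightarrow> X i \<in> A" "real_vec (X n) \<bullet> l < L" by blast
      then have "X \<in> E n" using stop_history[of n n X A] by (simp add: E_def hd_history)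
      then show ?thesis by blast
    qed simp
  qed
  then have "emeasure ?\<mu> (bad_exit A l L) \<le> emeasure ?\<mu> ((\<Union>n. E n) \<union> {X. \<forall>i. X i \<in> A})"
    using E_sets sets_stay by (intro emeasure_mono) (auto simp: sets_\<mu>)
  also have "\<dots> \<le> emeasure ?\<mu> (\<Union>n. E n) + emeasure ?\<mu> {X. \<forall>i. X i \<in> A}"
    using E_sets sets_stay by (intro emeasure_subadditive) (auto simp: sets_\<mu>)
  finally show ?thesis using UN by (simp add: emeasure_annealed_stay[OF \<open>finite A\<close>])
qed

end

section \<open>Geometry of the rotated box\<close>

lemma real_vec_axis: "real_vec y \<bullet> axis k 1 = real_of_int (y $ k)"
  by (simp add: real_vec_def inner_axis)

lemma orthogonal_matrix_inner:
  assumes "orthogonal_matrix (R :: real ^ 'd ^ 'd)"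
  shows "(R *v v) \<bullet> (R *v w) = v \<bullet> w"
proof -
  have "(R *v v) \<bullet> (R *v w) = (transpose R *v (R *v v)) \<bullet> w"
    by (simp add: dot_lmul_matrix[symmetric])
  also have "transpose R *v (R *v v) = v"
    using assms by (simp add: matrix_vector_mul_assoc orthogonal_matrix)
  finally show ?thesis .
qed

text \<open>The witness is the unique preimage of \<open>real_vec y\<close> under \<open>R\<close>.
  An orthogonal \<open>R\<close> fixing \<open>axis k 1\<close> preserves the norm and the
  coordinate along that axis.\<close>

lemma rotated_box_iff:
  fixes R :: "real ^ 'd ^ 'd::finite"
  assumes R: "orthogonal_matrix R" and Rk: "R *v axis k 1 = axis k 1"
  obtains v where "norm v = norm (real_vec y)" "v $ k = real_of_int (y $ k)"
    "y \<in> rotated_box k R L L' \<longleftrightarrow> \<bar>v $ k\<bar> < L \<and> (\<forall>i. i \<noteq> k \<longrightarrow> \<bar>v $ i\<bar> < L')"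
proof
  define v where "v = transpose R *v real_vec y"
  have Rv: "R *v v = real_vec y"
    using R by (simp add: v_def matrix_vector_mul_assoc orthogonal_matrix_def del: transpose_matrix_vector)
  have inj: "w = v" if "real_vec y = R *v w" for w
    using that R by (simp add: v_def matrix_vector_mul_assoc orthogonal_matrix_def del: transpose_matrix_vector)
  show "norm v = norm (real_vec y)"
    unfolding norm_eq_sqrt_inner Rv[symmetric] orthogonal_matrix_inner[OF R] ..
  show "v $ k = real_of_int (y $ k)"
    using orthogonal_matrix_inner[OF R, of v "axis k 1"] by (simp add: Rk Rv inner_axis real_vec_def)
  show "y \<in> rotated_box k R L L' \<longleftrightarrow> \<bar>v $ k\<bar> < L \<and> (\<forall>i. i \<noteq> k \<longrightarrow> \<bar>v $ i\<bar> < L')"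
    unfolding rotated_box_def using inj Rv[symmetric] by (auto simp: image_iff)
qed

lemma finite_rotated_box:
  fixes R :: "real ^ 'd ^ 'd::finite"
  assumes "orthogonal_matrix R" and "R *v axis k 1 = axis k 1"
  shows "finite (rotated_box k R L L')"
proof -
  \<comment> \<open>A coordinate of \<open>y\<close> is at most its Euclidean norm, which
    \<open>v\<close> shares, hence at most the l1 norm of \<open>v\<close>: a sum of
    \<open>CARD('d)\<close> terms, each at most \<open>max L L'\<close>.\<close>
  define N where "N = \<lceil>real CARD('d) * max L L'\<rceil>"
  have "vec_nth ` rotated_box k R L L' \<subseteq> (\<Pi>\<^sub>E i\<in>UNIV. {-N..N})"
  proof (intro image_subsetI PiE_I; simp?)
    fix y j assume y: "y \<in> rotated_box k R L L'"
    obtain v where v: "norm v = norm (real_vec y)"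
      "\<bar>v $ k\<bar> < L \<and> (\<forall>i. i \<noteq> k \<longrightarrow> \<bar>v $ i\<bar> < L')"
      using rotated_box_iff[OF assms, of y L L'] y by metis
    have "\<bar>real_of_int (y $ j)\<bar> \<le> norm (real_vec y)"
      using component_le_norm_cart[of "real_vec y" j] by (simp add: real_vec_def)
    also have "\<dots> \<le> (\<Sum>i\<in>UNIV. \<bar>v $ i\<bar>)" unfolding v(1)[symmetric] by (rule norm_le_l1_cart)
    also have "\<dots> \<le> (\<Sum>i\<in>(UNIV :: 'd set). max L L')"
      using v(2) by (intro sum_mono) (metis less_eq_real_def less_max_iff_disj)
    finally have "\<bar>real_of_int (y $ j)\<bar> \<le> real_of_int N" unfolding N_def by simp linarith
    then show "- N \<le> y $ j \<and> y $ j \<le> N" by linarith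
  qed
  then have "finite (vec_nth ` rotated_box k R L L')"
    by (rule finite_subset) (intro finite_PiE, auto)
  then show ?thesis by (rule finite_imageD) (auto simp: inj_on_def vec_eq_iff)
qed

text \<open>A large lateral coordinate is known only for the preimage under \<open>R\<close>. It
  transfers to \<open>y\<close> through the Euclidean norm, which \<open>R\<close> preserves, and
  then to the l1 norm needed to count sites.\<close>

lemma outside_rotated_box:
  fixes R :: "real ^ 'd ^ 'd::finite"
  assumes "orthogonal_matrix R" and "R *v axis k 1 = axis k 1"
    and "y \<notin> rotated_box k R L L'" and "real_of_int (y $ k) < L"
  shows "real_of_int (y $ k) \<le> - L \<or> L' \<le> real_of_int (\<Sum>i\<in>UNIV. \<bar>y $ i\<bar>)"
proof -
  obtain v where v: "norm v = norm (real_vec y)" "v $ k = real_of_int (y $ k)"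
    "\<not> (\<bar>v $ k\<bar> < L \<and> (\<forall>i. i \<noteq> k \<longrightarrow> \<bar>v $ i\<bar> < L'))"
    using rotated_box_iff[OF assms(1,2), of y L L'] assms(3) by metis
  show ?thesis
  proof (cases "\<bar>v $ k\<bar> < L")
    case True
    then obtain i where "L' \<le> \<bar>v $ i\<bar>" using v(3) by (auto simp: not_less)
    also have "\<dots> \<le> norm (real_vec y)" unfolding v(1)[symmetric] by (rule component_le_norm_cart)
    also have "\<dots> \<le> (\<Sum>i\<in>UNIV. \<bar>real_vec y $ i\<bar>)" by (rule norm_le_l1_cart)
    finally show ?thesis by (simp add: real_vec_def)
  qed (use v(2) assms(4) in auto)
qed

section \<open>Choice of scales and conclusion\<close>

context biased_iid_env
begin

text \<open>At a back exit \<open>q powr (- L)\<close> is reached by the position alone, as the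
  denominator is at most \<open>1\<close>. At a side exit the position gives only
  \<open>q powr L\<close>; the at least \<open>L'\<close> distinct sites supply the missing factor
  \<open>q powr (- 2 * L)\<close>.\<close>

lemma potential_ge:
  assumes h: "h \<in> histories 0 n" and L': "rate powr L' \<le> q powr (2 * L)"
    and y: "real_of_int (hd h $ k) \<le> - L \<or>
      real_of_int (hd h $ k) < L \<and> L' \<le> real_of_int (\<Sum>i\<in>UNIV. \<bar>hd h $ i\<bar>)"
  shows "q powr (- L) \<le> potential k q rate h"
proof -
  let ?c = "card (set (tl h))"
  have pot: "potential k q rate h = q powr real_of_int (hd h $ k) / rate powr real ?c"
    using q rate by (simp add: potential_def powr_realpow powr_real_of_int')
  from y show ?thesis
  proof
    assume "real_of_int (hd h $ k) \<le> - L"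
    then have "q powr (- L) \<le> q powr real_of_int (hd h $ k)" using q by (intro powr_mono') auto
    also have "\<dots> \<le> potential k q rate h"
    proof -
      have "rate powr real ?c \<le> 1" using rate by (intro powr_le1) auto
      then show ?thesis unfolding pot using rate by (simp add: pos_le_divide_eq mult_left_le)
    qed
    finally show ?thesis .
  next
    assume *: "real_of_int (hd h $ k) < L \<and> L' \<le> real_of_int (\<Sum>i\<in>UNIV. \<bar>hd h $ i\<bar>)"
    then have "L' \<le> real ?c" using l1_norm_le_card[OF h] by linarith
    then have "rate powr real ?c \<le> rate powr L'" using rate by (intro powr_mono') auto
    also note L'
    finally have 1: "rate powr real ?c \<le> q powr (2 * L)" .
    have "q powr (- L) = q powr L / q powr (2 * L)" using q by (simp add: powr_diff[symmetric])
    also have "\<dots> \<le> q powr real_of_int (hd h $ k) / rate powr real ?c"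
      using 1 * q rate by (intro frac_le powr_mono') auto
    finally show ?thesis unfolding pot .
  qed
qed

lemma measure_bad_exit_rotated_box:
  assumes "orthogonal_matrix R" and "R *v axis k 1 = axis k 1" and "rate powr L' \<le> q powr (2 * L)"
  shows "measure (annealed_law \<PP> 0) (bad_exit (rotated_box k R L L') (axis k 1) L) \<le> q powr L"
proof -
  have "emeasure (annealed_law \<PP> 0) (bad_exit (rotated_box k R L L') (axis k 1) L) \<le> ennreal (1 / q powr (- L))"
  proof (rule emeasure_bad_exit_le)
    show "q powr (- L) \<le> potential k q rate h"
      if "h \<in> histories 0 n" "hd h \<notin> rotated_box k R L L'" "real_vec (hd h) \<bullet> axis k 1 < L" for h n
      using that outside_rotated_box[OF assms(1,2)] by (intro potential_ge[OF _ assms(3)]) (auto simp: real_vec_axis)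
  qed (use finite_rotated_box[OF assms(1,2)] q in auto)
  then show ?thesis
    by (simp add: measure_def enn2real_leI powr_minus_divide)
qed

end

text \<open>After taking logarithms, a positive multiple of \<open>L\<^sup>2\<close> must dominate a
  multiple of \<open>L\<close>, and a positive multiple of \<open>L\<close> must dominate
  \<open>M * ln L\<close>; both hold for all large \<open>L\<close>.\<close>

lemma exponential_decay_scales:
  fixes q \<rho> M c :: real
  assumes q: "0 < q" "q < 1" and \<rho>: "0 < \<rho>" "\<rho> < 1"
  obtains L where "c \<le> L" "1 \<le> L" "\<rho> powr L\<^sup>2 \<le> q powr (2 * L)" "q powr L \<le> L powr (- M)"
proof -
  define a b where "a = - ln q" and "b = - ln \<rho>"
  have "a > 0" "b > 0" using assms by (simp_all add: a_def b_def)
  then have "eventually (\<lambda>L. exp (- (L\<^sup>2 * b)) \<le> exp (- (2 * L * a)) \<and> exp (- (L * a)) \<le> L powr (- M)) at_top"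
    by (intro eventually_conj; real_asymp)
  from eventually_happens[OF eventually_conj[OF this eventually_conj[OF eventually_ge_at_top[of c] eventually_ge_at_top[of 1]]]]
  show thesis using that assms by (auto simp: powr_def a_def b_def)
qed

theorem theorem4:
  fixes \<PP> :: "'d::finite env measure"
    and k :: 'd
    and R :: "real ^ 'd ^ 'd"
    and \<alpha> r :: real
  assumes "prob_space \<PP>" and "sets \<PP> = sets env_space"
    and "iid_env \<PP>"
    and "elliptic \<PP>"
    and "0 < \<alpha>" and "eta \<PP> (axis k 1) \<alpha> < \<infinity>"
    and "rotation_matrix R" and "R *v axis k 1 = axis k 1"
    and "1 < r"
    and "AE \<omega> in \<PP>. \<omega> 0 (axis k 1) = r * \<omega> 0 (- axis k 1)"
  shows "\<exists>M\<ge>15 * real CARD('d) + 5. polynomial_condition \<PP> \<alpha> k R M (axis k 1)"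
proof -
  \<comment> \<open>This base makes \<open>q\<^sup>2\<close> the ratio of backward to forward
    probability. It also minimises \<open>(s - 1) + (1 / s - 1) / r\<close> over positive
    \<open>s\<close>, the coefficient of the forward probability in the one-step change.\<close>
  define q where "q = 1 / sqrt r"
  have q: "0 < q" "q < 1" "q\<^sup>2 = 1 / r"
    using \<open>1 < r\<close> by (simp_all add: q_def power_divide)
  have "AE \<omega> in \<PP>. \<omega> 0 (- axis k 1) = q\<^sup>2 * \<omega> 0 (axis k 1)"
    using assms(10) by eventually_elim (use \<open>1 < r\<close> in \<open>simp add: q(3)\<close>)
  then interpret biased_iid_env \<PP> k q
    using assms(1-4) q by (simp add: biased_iid_env_def biased_iid_env_axioms_def)
  define M where "M = 15 * real CARD('d) + 5"
  obtain L where L: "c0 \<PP> (axis k 1) \<alpha> \<le> L" "1 \<le> L" "rate powr L\<^sup>2 \<le> q powr (2 * L)" "q powr L \<le> L powr (- M)"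
    using exponential_decay_scales[OF q(1,2) rate] .
  \<comment> \<open>The lateral half-width \<open>L\<^sup>2\<close> respects the cubic limit on the
    box because \<open>1 \<le> L\<close>.\<close>
  have "L\<^sup>2 \<le> 70 * L ^ 3"
    using power_increasing[of 2 3 L] zero_le_power[of L 3] L(2) by linarith
  moreover have "measure (annealed_law \<PP> 0) (bad_exit (rotated_box k R L (L\<^sup>2)) (axis k 1) L) \<le> q powr L"
    using assms(7,8) L(3) by (intro measure_bad_exit_rotated_box) (auto simp: rotation_matrix_def)
  ultimately have "polynomial_condition \<PP> \<alpha> k R M (axis k 1)"
    unfolding polynomial_condition_def using L
    by (intro exI[of _ L] exI[of _ "L\<^sup>2"]) auto
  then show ?thesis by (auto simp: M_def)
qed

end
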